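(* Let $\Gamma=(X,\mathcal{R})$ be a non-bipartite distance-regular graph with diameter $D\ge3$ having classical parameters $(D,q,\alpha,\beta)$ with $q<-1$, and fix $x\in X$. Assume the intersection number $a_1\ne0$ and that $\Gamma$ is not a near polygon. Then $\Gamma$ does not support a uniform structure with respect to $x$.
   Context: All graphs are finite, simple, connected and undirected, with distance $\partial$. For a fixed vertex $x$ of eccentricity $\varepsilon$: $V=\mathbb{C}^X$, $A$ the adjacency matrix, $E_i^*$ the diagonal $0/1$ matrix with $(y,y)$-entry $1$ iff $\partial(x,y)=i$; $L=\sum_{i=1}^{\varepsilon}E^*_{i-1}AE^*_i$, $R=\sum_{i=0}^{\varepsilon-1}E^*_{i+1}AE^*_i=L^\top$. $\Gamma_f$ is the graph on $X$ whose edges are the edges $yz$ of $\Gamma$ with $\partial(x,y)\ne\partial(x,z)$ (bipartite, with lowering/raising matrices $L,R$). A parameter matrix is a tridiagonal complex $U=(e_{ij})_{1\le i,j\le\varepsilon}$ with $e_{ii}=1$, with $e_{i,i-1}\neq0$ for all $2\le i\le\varepsilon$ or $e_{i-1,i}\ne0$ for all $2\le i\le\varepsilon$, and every principal submatrix $(e_{ij})_{s\le i,j\le t}$ nonsingular; $e_i^-=e_{i,i-1}$, $e_i^+=e_{i,i+1}$, $e_1^-=e_\varepsilon^+=0$. A bipartite graph admits a uniform structure w.r.t. $x$ if there exist such $U$ and $f\in\mathbb{C}^\varepsilon$ with $e_i^-RL^2+LRL+e_i^+L^2R=f_iL$ on $E_i^*V$ for all $1\le i\le\varepsilon$. A non-bipartite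 $\Gamma$ supports a uniform structure w.r.t. $x$ if $\Gamma_f$ admits one. Distance-regular: $p^h_{ij}=|\{w:\partial(y,w)=i,\partial(z,w)=j\}|$ depends only on $h=\partial(y,z),i,j$; $c_i=p^i_{1,i-1}$, $a_i=p^i_{1,i}$, $b_i=p^i_{1,i+1}$. Classical parameters $(D,q,\alpha,\beta)$: $c_i=[i](1+\alpha[i-1])$ ($1\le i\le D$), $b_i=([D]-[i])(\beta-\alpha[i])$ ($0\le i\le D-1$), $[j]=1+q+\dots+q^{j-1}$. A near polygon is a distance-regular graph with $a_i=a_1c_i$ for $1\le i\le D-1$ containing no induced $K_{1,1,2}$. *)

theory Defs
  imports "HOL-Analysis.Cartesian_Space" "Jordan_Normal_Form.Determinant"
begin

text \<open>
  A graph is given by its adjacency relation on a finite vertex type \<open>'a\<close>; the vertex set \<open>X\<close> is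
  the whole type, so that \<open>V\<close> is \<open>complex ^ 'a\<close>.
\<close>

definition connected_simple_graph :: "('a \<Rightarrow> 'a \<Rightarrow> bool) \<Rightarrow> bool" where
  "connected_simple_graph adj \<longleftrightarrow> symp adj \<and> irreflp adj \<and> (\<forall>y z. adj\<^sup>*\<^sup>* y z)"

definition bipartite :: "('a \<Rightarrow> 'a \<Rightarrow> bool) \<Rightarrow> bool" where
  "bipartite adj \<longleftrightarrow> (\<exists>S. \<forall>y z. adj y z \<longrightarrow> (y \<in> S \<longleftrightarrow> z \<notin> S))"

text \<open>Meaningful only if \<open>z\<close> is reachable from \<open>y\<close>.\<close>

definition gdist :: "('a \<Rightarrow> 'a \<Rightarrow> bool) \<Rightarrow> 'a \<Rightarrow> 'a \<Rightarrow> nat" where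
  "gdist adj y z = (LEAST n. (adj ^^ n) y z)"

definition ecc :: "('a::finite \<Rightarrow> 'a \<Rightarrow> bool) \<Rightarrow> 'a \<Rightarrow> nat" where
  "ecc adj x = Max (range (gdist adj x))"

definition diam :: "('a::finite \<Rightarrow> 'a \<Rightarrow> bool) \<Rightarrow> nat" where
  "diam adj = Max (range (ecc adj))"

subsection \<open>Uniform structures\<close>

definition adj_matrix :: "('a::finite \<Rightarrow> 'a \<Rightarrow> bool) \<Rightarrow> complex^'a^'a" where
  "adj_matrix adj = (\<chi> y z. of_bool (adj y z))"

definition dual_idem :: "('a::finite \<Rightarrow> 'a \<Rightarrow> bool) \<Rightarrow> 'a \<Rightarrow> nat \<Rightarrow> complex^'a^'a" where
  "dual_idem adj x i = (\<chi> y z. of_bool (y = z \<and> gdist adj x y = i))"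

definition lowering :: "('a::finite \<Rightarrow> 'a \<Rightarrow> bool) \<Rightarrow> 'a \<Rightarrow> complex^'a^'a" where
  "lowering adj x =
     (\<Sum>i = 1..ecc adj x. dual_idem adj x (i - 1) ** adj_matrix adj ** dual_idem adj x i)"

definition raising :: "('a::finite \<Rightarrow> 'a \<Rightarrow> bool) \<Rightarrow> 'a \<Rightarrow> complex^'a^'a" where
  "raising adj x =
     (\<Sum>i = 0..<ecc adj x. dual_idem adj x (i + 1) ** adj_matrix adj ** dual_idem adj x i)"

text \<open>
  An \<open>n \<times> n\<close> matrix \<open>(e i j)\<close> with \<open>1 \<le> i, j \<le> n\<close> is a function on indices of which only the values
  in that range matter. The constants \<open>Matrix.mat\<close> and \<open>Determinant.det\<close> index from \<open>0\<close>.
\<close>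

definition parameter_matrix :: "nat \<Rightarrow> (nat \<Rightarrow> nat \<Rightarrow> complex) \<Rightarrow> bool" where
  "parameter_matrix n e \<longleftrightarrow>
     (\<forall>i\<in>{1..n}. \<forall>j\<in>{1..n}. i + 1 < j \<or> j + 1 < i \<longrightarrow> e i j = 0) \<and>
     (\<forall>i\<in>{1..n}. e i i = 1) \<and>
     ((\<forall>i\<in>{2..n}. e i (i - 1) \<noteq> 0) \<or> (\<forall>i\<in>{2..n}. e (i - 1) i \<noteq> 0)) \<and>
     (\<forall>s t. 1 \<le> s \<and> s \<le> t \<and> t \<le> n \<longrightarrow>
        Determinant.det (Matrix.mat (t - s + 1) (t - s + 1) (\<lambda>(i, j). e (s + i) (s + j))) \<noteq> 0)"

definition e_minus :: "(nat \<Rightarrow> nat \<Rightarrow> complex) \<Rightarrow> nat \<Rightarrow> complex" where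
  "e_minus e i = (if i = 1 then 0 else e i (i - 1))"

definition e_plus :: "nat \<Rightarrow> (nat \<Rightarrow> nat \<Rightarrow> complex) \<Rightarrow> nat \<Rightarrow> complex" where
  "e_plus n e i = (if i = n then 0 else e i (i + 1))"

text \<open>
  Meant for a bipartite graph. Bipartiteness is not a conjunct: below it is applied only to
  \<open>flat_graph adj x\<close>, which is bipartite because its edges join vertices at distances
  from \<open>x\<close> that differ by one.
\<close>

definition admits_uniform_structure :: "('a::finite \<Rightarrow> 'a \<Rightarrow> bool) \<Rightarrow> 'a \<Rightarrow> bool" where
  "admits_uniform_structure adj x \<longleftrightarrow>
     (let n = ecc adj x; L = lowering adj x; R = raising adj x in
      \<exists>(e :: nat \<Rightarrow> nat \<Rightarrow> complex) (f :: nat \<Rightarrow> complex).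
        parameter_matrix n e \<and>
        (\<forall>i\<in>{1..n}. \<forall>v \<in> range ((*v) (dual_idem adj x i)).
           e_minus e i *s ((R ** L ** L) *v v) + (L ** R ** L) *v v
             + e_plus n e i *s ((L ** L ** R) *v v)
           = f i *s (L *v v)))"

definition flat_graph :: "('a \<Rightarrow> 'a \<Rightarrow> bool) \<Rightarrow> 'a \<Rightarrow> 'a \<Rightarrow> 'a \<Rightarrow> bool" where
  "flat_graph adj x y z \<longleftrightarrow> adj y z \<and> gdist adj x y \<noteq> gdist adj x z"

definition supports_uniform_structure :: "('a::finite \<Rightarrow> 'a \<Rightarrow> bool) \<Rightarrow> 'a \<Rightarrow> bool" where
  "supports_uniform_structure adj x \<longleftrightarrow> admits_uniform_structure (flat_graph adj x) x"

subsection \<open>Distance-regular graphs\<close>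

definition distance_regular :: "('a::finite \<Rightarrow> 'a \<Rightarrow> bool) \<Rightarrow> bool" where
  "distance_regular adj \<longleftrightarrow>
     (\<forall>i j y z y' z'. gdist adj y z = gdist adj y' z' \<longrightarrow>
        card {w. gdist adj y w = i \<and> gdist adj z w = j} =
        card {w. gdist adj y' w = i \<and> gdist adj z' w = j})"

text \<open>
  The number \<open>p\<^sup>h\<^sub>i\<^sub>j\<close>; it is meaningful only for a distance-regular graph and for \<open>h\<close> at most the
  diameter.
\<close>

definition intersection_number ::
    "('a::finite \<Rightarrow> 'a \<Rightarrow> bool) \<Rightarrow> nat \<Rightarrow> nat \<Rightarrow> nat \<Rightarrow> nat" where
  "intersection_number adj h i j =
     (THE k. \<forall>y z. gdist adj y z = h \<longrightarrow> card {w. gdist adj y w = i \<and> gdist adj z w = j} = k)"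

definition c_num :: "('a::finite \<Rightarrow> 'a \<Rightarrow> bool) \<Rightarrow> nat \<Rightarrow> nat" where
  "c_num adj i = intersection_number adj i 1 (i - 1)"

definition a_num :: "('a::finite \<Rightarrow> 'a \<Rightarrow> bool) \<Rightarrow> nat \<Rightarrow> nat" where
  "a_num adj i = intersection_number adj i 1 i"

definition b_num :: "('a::finite \<Rightarrow> 'a \<Rightarrow> bool) \<Rightarrow> nat \<Rightarrow> nat" where
  "b_num adj i = intersection_number adj i 1 (i + 1)"

definition q_bracket :: "real \<Rightarrow> nat \<Rightarrow> real" where
  "q_bracket q j = (\<Sum>k<j. q ^ k)"

definition has_classical_parameters ::
    "('a::finite \<Rightarrow> 'a \<Rightarrow> bool) \<Rightarrow> nat \<Rightarrow> real \<Rightarrow> real \<Rightarrow> real \<Rightarrow> bool" where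
  "has_classical_parameters adj D q \<alpha> \<beta> \<longleftrightarrow>
     diam adj = D \<and>
     (\<forall>i\<in>{1..D}. real (c_num adj i) = q_bracket q i * (1 + \<alpha> * q_bracket q (i - 1))) \<and>
     (\<forall>i<D. real (b_num adj i) = (q_bracket q D - q_bracket q i) * (\<beta> - \<alpha> * q_bracket q i))"

text \<open>Here \<open>K\<^sub>1\<^sub>,\<^sub>1\<^sub>,\<^sub>2\<close> has the parts \<open>{u}\<close>, \<open>{v}\<close> and \<open>{w, z}\<close>.\<close>

definition has_induced_K112 :: "('a \<Rightarrow> 'a \<Rightarrow> bool) \<Rightarrow> bool" where
  "has_induced_K112 adj \<longleftrightarrow>
     (\<exists>u v w z. distinct [u, v, w, z] \<and>
        adj u v \<and> adj u w \<and> adj u z \<and> adj v w \<and> adj v z \<and> \<not> adj w z)"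

definition near_polygon :: "('a::finite \<Rightarrow> 'a \<Rightarrow> bool) \<Rightarrow> bool" where
  "near_polygon adj \<longleftrightarrow>
     distance_regular adj \<and>
     (\<forall>i. 1 \<le> i \<and> i < diam adj \<longrightarrow> a_num adj i = a_num adj 1 * c_num adj i) \<and>
     \<not> has_induced_K112 adj"

end

theory Submission imports Defs begin

text \<open>
  Write \<open>N y z = q powi (- d y z)\<close>, let \<open>D\<^sub>z\<close> be the diagonal matrix with the entries \<open>N z y\<close>, and let
  \<open>A\<close> be the adjacency matrix. On functions of the distance from \<open>z\<close>, the classical parameters make \<open>A\<close>
  and \<open>D\<^sub>z\<close> satisfy an Askey-Wilson relation; hence the commutator \<open>T D\<^sub>z\<close> of \<open>A\<close> with
  \<open>A\<^sup>2 D\<^sub>z - (q + 1/q) A D\<^sub>z A + D\<^sub>z A\<^sup>2 - \<gamma> (A D\<^sub>z + D\<^sub>z A) - \<rho> D\<^sub>z\<close> vanishes on these functions. Since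
  \<open>N\<^sup>2\<close> is a combination of \<open>N\<close> and the all-ones matrix, and \<open>T\<close> is self-adjoint for the Frobenius inner
  product, the sum over \<open>z\<close> of the squared norms of \<open>T D\<^sub>z\<close> vanishes, so \<open>T D\<^sub>z = 0\<close> on the whole space.

  The entries of \<open>T D\<^sub>z\<close> and \<open>A (T D\<^sub>z) + (T D\<^sub>z) A\<close> at vertices \<open>x\<close>, \<open>y\<close> at distance two give a balanced
  set condition. For \<open>z\<close> adjacent to \<open>x\<close> and at distance two from \<open>y\<close> it says that the number of certain
  parallelograms is \<open>q\<close> times the number of certain kites. As \<open>q < 0\<close>, both numbers are zero, so there are
  no parallelograms of length three, no kites of length three, and no induced \<open>K\<^sub>1\<^sub>,\<^sub>1\<^sub>,\<^sub>2\<close>.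

  Now read the uniform structure relation for \<open>i = 2\<close> at \<open>z\<close> adjacent to \<open>x\<close> and \<open>y\<close> at distance two from
  both. If a common neighbour of \<open>x\<close> and \<open>z\<close> is adjacent to \<open>y\<close>, it reads \<open>e\<^sup>- c\<^sub>2 + (c\<^sub>2 - 1)\<^sup>2 = 0\<close>; if there
  is none, it reads \<open>e\<^sup>- c\<^sub>2 + c\<^sub>2 (c\<^sub>2 - 1) = 0\<close>. The second case occurs because \<open>a\<^sub>2 \<noteq> a\<^sub>1 c\<^sub>2\<close> when the graph
  is not a near polygon. So \<open>c\<^sub>2 = 1\<close> and \<open>e\<^sup>- = 0\<close>, hence \<open>e\<^sup>+ \<noteq> 0\<close>, and the relation at \<open>y\<close> and \<open>z\<close> at distance
  three forces \<open>c\<^sub>3 \<le> c\<^sub>2 = 1\<close>, against \<open>c\<^sub>3 = 1 - q\<^sup>3 > 1\<close>.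
\<close>

section \<open>Self-adjoint maps on matrices\<close>

no_notation vec_index (infixl "$" 100)

text \<open>\<open>T\<close> is a real polynomial in two commuting self-adjoint maps, hence
  self-adjoint. They will be left and right multiplication by the adjacency matrix; keeping them
  abstract makes the expansion commutative.\<close>

lemma selfadjoint_cubic_commutator:
  fixes l r :: "'b::real_inner \<Rightarrow> 'b" and \<beta> \<gamma> \<rho> :: real
  assumes l: "linear l" and r: "linear r" and comm: "\<And>Z. r (l Z) = l (r Z)"
    and sl: "\<And>Z W. inner (l Z) W = inner Z (l W)"
    and sr: "\<And>Z W. inner (r Z) W = inner Z (r W)"
  defines "P \<equiv> \<lambda>Z. l (l Z) - \<beta> *\<^sub>R l (r Z) + r (r Z) - \<gamma> *\<^sub>R (l Z + r Z) - \<rho> *\<^sub>R Z"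
  defines "T \<equiv> \<lambda>Z. l (P Z) - r (P Z)"
  shows "linear T" and "inner (T Z) W = inner Z (T W)"
proof -
  note lin = linear_add[OF l] linear_add[OF r] linear_diff[OF l] linear_diff[OF r]
    linear_cmul[OF l] linear_cmul[OF r]
  show "linear T"
    by (rule linearI) (simp_all add: T_def P_def lin algebra_simps)
  show "inner (T Z) W = inner Z (T W)"
    by (simp add: T_def P_def lin comm inner_diff_left inner_diff_right inner_add_left
        inner_add_right sl sr algebra_simps)
qed

section \<open>Multiplication by a matrix and the Frobenius inner product\<close>

lemma matrix_mult_linear_left: "linear (\<lambda>Z::real^'n^'m. (A::real^'m^'k) ** Z)"
  by (rule linearI)
     (simp_all add: matrix_add_ldistrib matrix_matrix_mult_def Finite_Cartesian_Product.vec_eq_iff sum_distrib_left mult_ac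
       distrib_left sum.distrib)

lemma matrix_mult_linear_right: "linear (\<lambda>Z::real^'n^'m. Z ** (A::real^'k^'n))"
  by (rule linearI)
     (simp_all add: matrix_matrix_mult_def Finite_Cartesian_Product.vec_eq_iff sum_distrib_left mult_ac distrib_left
       distrib_right sum.distrib)

lemma inner_matrix: "inner Z W = (\<Sum>i\<in>UNIV. \<Sum>j\<in>UNIV. Z $ i $ j * W $ i $ j)"
  for Z W :: "real^'n^'m"
  by (simp add: inner_vec_def)

lemma inner_symmetric_mult_left:
  fixes A :: "real^'n^'n" and Z W :: "real^'m^'n"
  assumes "\<And>i j. A $ i $ j = A $ j $ i"
  shows "inner (A ** Z) W = inner Z (A ** W)"
proof -
  have "inner (A ** Z) W = (\<Sum>i\<in>UNIV. \<Sum>j\<in>UNIV. \<Sum>k\<in>UNIV. A $ i $ k * Z $ k $ j * W $ i $ j)"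
    by (simp add: inner_matrix matrix_matrix_mult_def sum_distrib_right)
  also have "\<dots> = (\<Sum>k\<in>UNIV. \<Sum>j\<in>UNIV. \<Sum>i\<in>UNIV. A $ i $ k * Z $ k $ j * W $ i $ j)"
    by (subst sum.swap, subst (2) sum.swap, subst sum.swap, rule refl)
  also have "\<dots> = inner Z (A ** W)"
    by (simp add: inner_matrix matrix_matrix_mult_def sum_distrib_left assms mult_ac)
  finally show ?thesis .
qed

lemma inner_symmetric_mult_right:
  fixes A :: "real^'n^'n" and Z W :: "real^'n^'m"
  assumes "\<And>i j. A $ i $ j = A $ j $ i"
  shows "inner (Z ** A) W = inner Z (W ** A)"
proof -
  have "inner (Z ** A) W = (\<Sum>i\<in>UNIV. \<Sum>j\<in>UNIV. \<Sum>k\<in>UNIV. Z $ i $ k * A $ k $ j * W $ i $ j)"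
    by (simp add: inner_matrix matrix_matrix_mult_def sum_distrib_right)
  also have "\<dots> = (\<Sum>i\<in>UNIV. \<Sum>k\<in>UNIV. \<Sum>j\<in>UNIV. Z $ i $ k * A $ k $ j * W $ i $ j)"
    by (subst (2) sum.swap, rule refl)
  also have "\<dots> = inner Z (W ** A)"
    by (simp add: inner_matrix matrix_matrix_mult_def sum_distrib_left mult_ac)
       (simp add: assms)
  finally show ?thesis .
qed

definition diag_matrix :: "('n::finite \<Rightarrow> real) \<Rightarrow> real^'n^'n" where
  "diag_matrix f = (\<chi> i j. if i = j then f i else 0)"

lemma diag_matrix_entry [simp]: "diag_matrix f $ i $ j = (if i = j then f i else 0)"
  by (simp add: diag_matrix_def)

lemma diag_matrix_mult_vec: "(diag_matrix f *v v) $ i = f i * v $ i"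
  by (simp add: matrix_vector_mult_def if_distrib[where f="\<lambda>t. t * _"] cong: if_cong)

lemma inner_diag_matrix: "inner (diag_matrix f) W = (\<Sum>i\<in>UNIV. f i * W $ i $ i)"
  by (simp add: inner_matrix if_distrib[where f="\<lambda>t. t * _"] cong: if_cong)

text \<open>
  With \<open>D\<^sub>z = diag_matrix (N z)\<close>, the sum over \<open>z\<close> of the squared norms of \<open>T D\<^sub>z\<close> is the sum over \<open>a\<close> of the
  entries \<open>(a, a)\<close> of \<open>T (T (\<Sum>z. N z a * D\<^sub>z))\<close>, and the innermost sum is a combination of \<open>D\<^sub>a\<close> and
  the identity.
\<close>

lemma selfadjoint_zero_on_diagonals:
  fixes T :: "real^'n^'n \<Rightarrow> real^'n^'n" and N :: "'n::finite \<Rightarrow> 'n \<Rightarrow> real"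
  assumes T: "linear T" and adj: "\<And>Z W. inner (T Z) W = inner Z (T W)"
    and TI: "T (diag_matrix (\<lambda>_. 1)) = 0"
    and N2: "\<And>a b. (\<Sum>z\<in>UNIV. N z a * N z b) = \<kappa> * N a b + \<mu>"
    and loc: "\<And>a. T (T (diag_matrix (N a))) $ a $ a = 0"
  shows "T (diag_matrix (N z)) = 0"
proof -
  let ?D = "\<lambda>a. diag_matrix (N a)"
  let ?S = "\<lambda>Z. T (T Z)"
  have S: "linear ?S"
    using linear_compose[OF T T] by (simp add: o_def)
  have "(\<Sum>z\<in>UNIV. inner (T (?D z)) (T (?D z))) = (\<Sum>z\<in>UNIV. \<Sum>a\<in>UNIV. N z a * ?S (?D z) $ a $ a)"
    by (simp add: adj inner_diag_matrix)
  also have "\<dots> = (\<Sum>a\<in>UNIV. \<Sum>z\<in>UNIV. N z a * ?S (?D z) $ a $ a)"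
    by (rule sum.swap)
  also have "\<dots> = (\<Sum>a\<in>UNIV. ?S (\<Sum>z\<in>UNIV. N z a *\<^sub>R ?D z) $ a $ a)"
    by (simp add: linear_sum[OF S] linear_cmul[OF S] del: diag_matrix_entry)
  also have "\<dots> = (\<Sum>a\<in>UNIV. ?S (\<kappa> *\<^sub>R ?D a + \<mu> *\<^sub>R diag_matrix (\<lambda>_. 1)) $ a $ a)"
  proof (rule sum.cong[OF refl])
    fix a
    have "(\<Sum>z\<in>UNIV. N z a *\<^sub>R ?D z) = \<kappa> *\<^sub>R ?D a + \<mu> *\<^sub>R diag_matrix (\<lambda>_. 1)"
      by (simp add: Finite_Cartesian_Product.vec_eq_iff N2)
    then show "?S (\<Sum>z\<in>UNIV. N z a *\<^sub>R ?D z) $ a $ a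
        = ?S (\<kappa> *\<^sub>R ?D a + \<mu> *\<^sub>R diag_matrix (\<lambda>_. 1)) $ a $ a" by simp
  qed
  also have "\<dots> = 0"
    by (simp add: linear_add[OF S] linear_cmul[OF S] loc TI linear_0[OF T])
  finally have "\<forall>z. inner (T (?D z)) (T (?D z)) = 0"
    by (subst (asm) sum_nonneg_eq_0_iff) auto
  then show ?thesis by simp
qed

section \<open>The Askey-Wilson relation\<close>

text \<open>Sequences are indexed by integers so that no subtraction is truncated at distance zero.\<close>

definition three_term :: "(int \<Rightarrow> real) \<Rightarrow> (int \<Rightarrow> real) \<Rightarrow> (int \<Rightarrow> real) \<Rightarrow> (int \<Rightarrow> real) \<Rightarrow> int \<Rightarrow> real" where
  "three_term c a b \<phi> h = c h * \<phi> (h - 1) + a h * \<phi> h + b h * \<phi> (h + 1)"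

text \<open>The left-hand side is a five-term expression in the values of \<open>\<phi>\<close>.
  \<open>E2\<close> cancels the terms at \<open>h - 2\<close> and \<open>h + 2\<close>,
  \<open>E1\<close> taken at \<open>h - 1\<close> and at \<open>h\<close> evaluates those at
  \<open>h - 1\<close> and \<open>h + 1\<close>, and \<open>E0\<close> evaluates the one at
  \<open>h\<close>.\<close>

lemma askey_wilson_three_term:
  fixes c a b K \<phi> :: "int \<Rightarrow> real"
  assumes E2: "\<And>h. K (h + 1) - \<beta> * K h + K (h - 1) = 0"
    and E1: "\<And>h. (a h + a (h + 1)) * (K h + K (h + 1)) - \<beta> * (a h * K h + a (h + 1) * K (h + 1))
               - \<gamma> * (K h + K (h + 1)) = \<omega>"
    and E0: "\<And>h. 2 * K h * (c h * b (h - 1) + (a h)\<^sup>2 + b h * c (h + 1))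
               - \<beta> * (c h * b (h - 1) * K (h - 1) + (a h)\<^sup>2 * K h + b h * c (h + 1) * K (h + 1))
               - 2 * \<gamma> * a h * K h - \<rho> * K h = \<omega> * a h + \<eta>"
  defines "B \<equiv> three_term c a b"
  defines "M \<equiv> \<lambda>\<psi> h. K h * \<psi> h"
  shows "B (B (M \<phi>)) h - \<beta> * B (M (B \<phi>)) h + M (B (B \<phi>)) h - \<gamma> * (B (M \<phi>) h + M (B \<phi>) h) - \<rho> * M \<phi> h
       = \<omega> * B \<phi> h + \<eta> * \<phi> h"
proof -
  have e0: "K (h - 2) = \<beta> * K (h - 1) - K h" using E2[of "h - 1"] by (simp add: algebra_simps)
  have e4: "K (h + 2) = \<beta> * K (h + 1) - K h" using E2[of "h + 1"] by (simp add: algebra_simps)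
  have e1: "(a (h - 1) + a h) * (K (h - 1) + K h) - \<beta> * (a (h - 1) * K (h - 1) + a h * K h)
               - \<gamma> * (K (h - 1) + K h) - \<omega> = 0" using E1[of "h - 1"] by simp
  have e3: "(a h + a (h + 1)) * (K h + K (h + 1)) - \<beta> * (a h * K h + a (h + 1) * K (h + 1))
               - \<gamma> * (K h + K (h + 1)) - \<omega> = 0" using E1[of h] by simp
  have e2: "2 * K h * (c h * b (h - 1) + (a h)\<^sup>2 + b h * c (h + 1))
               - \<beta> * (c h * b (h - 1) * K (h - 1) + (a h)\<^sup>2 * K h + b h * c (h + 1) * K (h + 1))
               - 2 * \<gamma> * a h * K h - \<rho> * K h - \<omega> * a h - \<eta> = 0" using E0[of h] by simp
  have s: "h - 1 - 1 = h - 2" "h + 1 + 1 = h + 2" "h - 1 + 1 = h" "h + 1 - 1 = h" by auto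
  have "B (B (M \<phi>)) h - \<beta> * B (M (B \<phi>)) h + M (B (B \<phi>)) h - \<gamma> * (B (M \<phi>) h + M (B \<phi>) h) - \<rho> * M \<phi> h
       - (\<omega> * B \<phi> h + \<eta> * \<phi> h)
     = c h * ((a (h - 1) + a h) * (K (h - 1) + K h) - \<beta> * (a (h - 1) * K (h - 1) + a h * K h)
               - \<gamma> * (K (h - 1) + K h) - \<omega>) * \<phi> (h - 1)
     + b h * ((a h + a (h + 1)) * (K h + K (h + 1)) - \<beta> * (a h * K h + a (h + 1) * K (h + 1))
               - \<gamma> * (K h + K (h + 1)) - \<omega>) * \<phi> (h + 1)
     + (2 * K h * (c h * b (h - 1) + (a h)\<^sup>2 + b h * c (h + 1))
               - \<beta> * (c h * b (h - 1) * K (h - 1) + (a h)\<^sup>2 * K h + b h * c (h + 1) * K (h + 1))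
               - 2 * \<gamma> * a h * K h - \<rho> * K h - \<omega> * a h - \<eta>) * \<phi> h"
    unfolding B_def M_def three_term_def s e0 e4
    by (simp add: algebra_simps power2_eq_square)
  then show ?thesis unfolding e1 e2 e3 by simp
qed

definition askey_wilson ::
    "real \<Rightarrow> real \<Rightarrow> real \<Rightarrow> real \<Rightarrow> real \<Rightarrow> (int \<Rightarrow> real) \<Rightarrow> (int \<Rightarrow> real) \<Rightarrow> (int \<Rightarrow> real) \<Rightarrow> bool" where
  "askey_wilson q \<gamma> \<rho> \<omega> \<eta> c a b \<longleftrightarrow> (\<forall>\<phi> h. let K = \<lambda>j. q powi (- j) in
       three_term c a b (three_term c a b (\<lambda>j. K j * \<phi> j)) h
     - (q + 1 / q) * three_term c a b (\<lambda>j. K j * three_term c a b \<phi> j) h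
     + K h * three_term c a b (three_term c a b \<phi>) h
     - \<gamma> * (three_term c a b (\<lambda>j. K j * \<phi> j) h + K h * three_term c a b \<phi> h) - \<rho> * (K h * \<phi> h)
       = \<omega> * three_term c a b \<phi> h + \<eta> * \<phi> h)"

text \<open>A shift of \<open>h\<close> multiplies \<open>t h\<close> by a constant, so
  \<open>E1\<close> and \<open>E0\<close> become polynomial identities in \<open>t h\<close>. The
  leading coefficient of \<open>b\<close> is \<open>q\<close> times that of \<open>c\<close>; this
  ratio cancels the top coefficient \<open>f4\<close> and, in the second conclusion, the term in
  \<open>t h\<close>.\<close>

lemma askey_wilson_quadratic:
  fixes q k c0 c1 c2 b0 b1 :: real
  assumes q: "q \<noteq> 0"
  defines "t \<equiv> \<lambda>h::int. q powi h"
  defines "c \<equiv> \<lambda>h. c2 * (t h)\<^sup>2 + c1 * t h + c0"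
  defines "b \<equiv> \<lambda>h. q * c2 * (t h)\<^sup>2 + b1 * t h + b0"
  defines "a \<equiv> \<lambda>h. k - b h - c h"
  defines "K \<equiv> \<lambda>h::int. q powi (- h)"
  shows "\<exists>\<gamma> \<rho> \<omega> \<eta>. askey_wilson q \<gamma> \<rho> \<omega> \<eta> c a b"
    and "\<exists>\<theta> \<kappa>. \<forall>h. three_term c a b K h = \<theta> * K h + \<kappa>"
proof -
  define p where "p = 1 / q"
  have pq: "q * p = 1" by (simp add: p_def q)
  have pq': "p * q = 1" "p * (q * x) = x" for x by (simp_all add: p_def q)
  define a1 where "a1 = - b1 - c1"
  define a0 where "a0 = k - b0 - c0"
  define a2 where "a2 = - (1 + q) * c2"
  have a: "a h = a2 * (t h)\<^sup>2 + a1 * t h + a0" for h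
    by (simp add: a_def b_def c_def a0_def a1_def a2_def algebra_simps)
  have t1: "t (h + 1) = t h * q" "t (h - 1) = t h * p" for h
    by (simp_all add: t_def power_int_add power_int_diff q p_def)
  have K1: "K (h + 1) = K h * p" "K (h - 1) = K h * q" for h
    by (simp_all add: K_def power_int_add power_int_diff power_int_minus q p_def field_simps)
  have tK: "t h * K h = 1" for h
    by (simp add: t_def K_def power_int_minus q)
  \<comment> \<open>Comparing coefficients forces these values: \<open>\<gamma>\<close> makes
    \<open>g0\<close> vanish, \<open>\<omega>\<close> equals \<open>g1\<close>, and
    \<open>\<rho>\<close> and \<open>\<eta>\<close> make \<open>f0\<close> and \<open>f1\<close>
    vanish. The other coefficients then vanish as well.\<close>
  define \<gamma> where "\<gamma> = - (q - 1)\<^sup>2 * a0 * p"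
  define \<omega> where "\<omega> = - (q - 1)\<^sup>2 * a1 * p"
  define \<rho> where "\<rho> = - (q - p)\<^sup>2 * c0 * b0 + (q - 1)\<^sup>2 * p * a0\<^sup>2"
  define \<eta> where "\<eta> = (1 - q\<^sup>2) * (c1 * b0 + c0 * b1 * p) + (1 - p\<^sup>2) * (b1 * c0 + b0 * c1 * q)
     + a0 * a1 * (q - 1)\<^sup>2 * p"
  have E2: "K (h + 1) - (q + 1 / q) * K h + K (h - 1) = 0" for h
    unfolding K1 p_def[symmetric] by (simp add: algebra_simps)
  have E1: "(a h + a (h + 1)) * (K h + K (h + 1)) - (q + 1 / q) * (a h * K h + a (h + 1) * K (h + 1))
               - \<gamma> * (K h + K (h + 1)) = \<omega>" for h
  proof -
    define g2 where "g2 = a2 * ((1 + q\<^sup>2) * (1 + p) - (q + p) * (1 + q\<^sup>2 * p))"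
    define g1 where "g1 = a1 * ((1 + q) * (1 + p) - (q + p) * (1 + q * p))"
    define g0 where "g0 = a0 * (2 * (1 + p) - (q + p) * (1 + p)) - \<gamma> * (1 + p)"
    have "(a h + a (h + 1)) * (K h + K (h + 1)) - (q + p) * (a h * K h + a (h + 1) * K (h + 1))
               - \<gamma> * (K h + K (h + 1)) = g2 * (t h * (t h * K h)) + g1 * (t h * K h) + g0 * K h"
      unfolding a t1 K1 g2_def g1_def g0_def by (simp add: algebra_simps power2_eq_square)
    moreover have "g2 = 0" "g1 = \<omega>" "g0 = 0"
      unfolding g2_def g1_def g0_def \<gamma>_def \<omega>_def
      by (simp_all add: algebra_simps power2_eq_square pq')
    ultimately show ?thesis using tK[of h] unfolding p_def by simp
  qed
  \<comment> \<open>This is \<open>E0\<close> multiplied by \<open>t h\<close>, with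
    \<open>t h * K h = 1\<close> and \<open>x\<close> in place of \<open>t h\<close>.\<close>
  have quartic: "(1 - q\<^sup>2) * ((c2 * x\<^sup>2 + c1 * x + c0) * (q * c2 * (x * p)\<^sup>2 + b1 * (x * p) + b0))
      + (1 - p\<^sup>2) * ((q * c2 * x\<^sup>2 + b1 * x + b0) * (c2 * (x * q)\<^sup>2 + c1 * (x * q) + c0))
      - (q - 1)\<^sup>2 * p * (a2 * x\<^sup>2 + a1 * x + a0)\<^sup>2 - 2 * \<gamma> * (a2 * x\<^sup>2 + a1 * x + a0) - \<rho>
      - \<omega> * (a2 * x\<^sup>2 + a1 * x + a0) * x - \<eta> * x = 0" (is "?F = 0") for x
  proof -
    define f4 where "f4 = (1 - q\<^sup>2) * c2 * (q * c2) * p\<^sup>2 + (1 - p\<^sup>2) * (q * c2) * c2 * q\<^sup>2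
        - (q - 1)\<^sup>2 * p * a2\<^sup>2"
    define f3 where "f3 = (1 - q\<^sup>2) * (c2 * b1 * p + c1 * (q * c2) * p\<^sup>2)
        + (1 - p\<^sup>2) * (q * c2 * c1 * q + b1 * c2 * q\<^sup>2) - 2 * (q - 1)\<^sup>2 * p * a2 * a1 - \<omega> * a2"
    define f2 where "f2 = (1 - q\<^sup>2) * (c2 * b0 + c1 * b1 * p + c0 * (q * c2) * p\<^sup>2)
        + (1 - p\<^sup>2) * (q * c2 * c0 + b1 * c1 * q + b0 * c2 * q\<^sup>2)
        - (q - 1)\<^sup>2 * p * (a1\<^sup>2 + 2 * a0 * a2) - 2 * \<gamma> * a2 - \<omega> * a1"
    define f1 where "f1 = (1 - q\<^sup>2) * (c1 * b0 + c0 * b1 * p) + (1 - p\<^sup>2) * (b1 * c0 + b0 * c1 * q)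
        - 2 * (q - 1)\<^sup>2 * p * a0 * a1 - 2 * \<gamma> * a1 - \<omega> * a0 - \<eta>"
    define f0 where "f0 = (1 - q\<^sup>2) * c0 * b0 + (1 - p\<^sup>2) * b0 * c0 - (q - 1)\<^sup>2 * p * a0\<^sup>2
        - 2 * \<gamma> * a0 - \<rho>"
    have "?F = f4 * x ^ 4 + f3 * x ^ 3 + f2 * x\<^sup>2 + f1 * x + f0"
      unfolding f4_def f3_def f2_def f1_def f0_def
      by (simp add: algebra_simps power2_eq_square power3_eq_cube power4_eq_xxxx)
    moreover have "f4 = 0" "f3 = 0" "f2 = 0" "f1 = 0" "f0 = 0"
      unfolding f4_def f3_def f2_def f1_def f0_def a2_def a1_def \<gamma>_def \<omega>_def \<eta>_def \<rho>_def
      by (simp_all add: algebra_simps power2_eq_square pq')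
    ultimately show ?thesis by simp
  qed
  have E0: "2 * K h * (c h * b (h - 1) + (a h)\<^sup>2 + b h * c (h + 1))
               - (q + 1 / q) * (c h * b (h - 1) * K (h - 1) + (a h)\<^sup>2 * K h + b h * c (h + 1) * K (h + 1))
               - 2 * \<gamma> * a h * K h - \<rho> * K h = \<omega> * a h + \<eta>" for h
  proof -
    have F: "(1 - q\<^sup>2) * (c h * b (h - 1)) + (1 - p\<^sup>2) * (b h * c (h + 1))
      - (q - 1)\<^sup>2 * p * (a h)\<^sup>2 - 2 * \<gamma> * a h - \<rho> - \<omega> * a h * t h - \<eta> * t h = 0"
      using quartic[of "t h"] unfolding a b_def c_def t1 by (simp add: mult.assoc)
    have "2 * K h * (c h * b (h - 1) + (a h)\<^sup>2 + b h * c (h + 1))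
               - (q + p) * (c h * b (h - 1) * (K h * q) + (a h)\<^sup>2 * K h + b h * c (h + 1) * (K h * p))
               - 2 * \<gamma> * a h * K h - \<rho> * K h - (\<omega> * a h + \<eta>) * (t h * K h)
      = K h * ((2 - q\<^sup>2 - p * q) * (c h * b (h - 1)) + (2 - p * q - p\<^sup>2) * (b h * c (h + 1))
      + (2 - q - p) * (a h)\<^sup>2 - 2 * \<gamma> * a h - \<rho> - \<omega> * a h * t h - \<eta> * t h)" (is "_ = K h * ?G")
      by (simp add: algebra_simps power2_eq_square)
    moreover have "2 - q\<^sup>2 - p * q = 1 - q\<^sup>2" "2 - p * q - p\<^sup>2 = 1 - p\<^sup>2"
      by (simp_all add: pq')
    moreover have "2 - q - p = - ((q - 1)\<^sup>2 * p)"
      by (simp add: algebra_simps power2_eq_square pq')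
    ultimately have "2 * K h * (c h * b (h - 1) + (a h)\<^sup>2 + b h * c (h + 1))
               - (q + p) * (c h * b (h - 1) * (K h * q) + (a h)\<^sup>2 * K h + b h * c (h + 1) * (K h * p))
               - 2 * \<gamma> * a h * K h - \<rho> * K h - (\<omega> * a h + \<eta>) * (t h * K h) = 0"
      using F by simp
    then show ?thesis unfolding K1 p_def[symmetric] tK by simp
  qed
  show "\<exists>\<gamma> \<rho> \<omega> \<eta>. askey_wilson q \<gamma> \<rho> \<omega> \<eta> c a b"
    using askey_wilson_three_term[OF E2 E1 E0] unfolding askey_wilson_def Let_def K_def by blast
  have "three_term c a b K h = (k + (q - 1) * c0 + (p - 1) * b0) * K h + ((q - 1) * c1 + (p - 1) * b1)" for h
  proof -
    have "three_term c a b K h = (k + (q - 1) * c0 + (p - 1) * b0) * K h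
        + ((q - 1) * c1 + (p - 1) * b1) * (t h * K h) + c2 * (p * q - 1) * t h * (t h * K h)"
      unfolding three_term_def K1 a_def b_def c_def by (simp add: algebra_simps power2_eq_square)
    then show ?thesis unfolding tK pq' by simp
  qed
  then show "\<exists>\<theta> \<kappa>. \<forall>h. three_term c a b K h = \<theta> * K h + \<kappa>" by blast
qed

section \<open>Distance-regular graphs\<close>

lemma gdist_le: "(adj ^^ n) y z \<Longrightarrow> gdist adj y z \<le> n"
  unfolding gdist_def by (rule Least_le)

lemma relpowp_gdist:
  assumes "adj\<^sup>*\<^sup>* y z"
  shows "(adj ^^ gdist adj y z) y z"
  using assms unfolding gdist_def rtranclp_power by (rule LeastI_ex)

locale distance_regular_graph =
  fixes adj :: "'a::finite \<Rightarrow> 'a \<Rightarrow> bool"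
  assumes graph: "connected_simple_graph adj"
    and regular: "distance_regular adj"
begin

abbreviation d :: "'a \<Rightarrow> 'a \<Rightarrow> nat" where "d \<equiv> gdist adj"

lemma adj_sym: "adj y z \<Longrightarrow> adj z y"
  using graph by (auto simp: connected_simple_graph_def dest: sympD)

lemma adj_irrefl [simp]: "\<not> adj y y"
  using graph by (auto simp: connected_simple_graph_def dest: irreflpD)

lemma adj_commute: "adj y z \<longleftrightarrow> adj z y"
  using adj_sym by blast

lemma path_dist: "(adj ^^ d y z) y z"
  using graph by (intro relpowp_gdist) (auto simp: connected_simple_graph_def)

lemma dist_commute: "d y z = d z y"
proof -
  have "(adj ^^ n) u v \<Longrightarrow> (adj ^^ n) v u" for n u v
    by (induction n arbitrary: v) (auto intro: relpowp_Suc_I2 adj_sym elim!: relpowp_Suc_E simp del: relpowp.simps(2))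
  then have "(adj ^^ n) u v \<longleftrightarrow> (adj ^^ n) v u" for n u v
    by blast
  then show ?thesis by (simp add: gdist_def)
qed

lemma dist_triangle: "d y z \<le> d y w + d w z"
proof (rule gdist_le)
  show "(adj ^^ (d y w + d w z)) y z"
    unfolding relpowp_add using path_dist by (auto simp: OO_def)
qed

lemma dist_eq_0_iff [simp]: "d y z = 0 \<longleftrightarrow> y = z"
proof
  assume "d y z = 0" then show "y = z" using path_dist[of y z] by simp
qed (use gdist_le[of 0 adj y y] in simp)

lemma dist_self [simp]: "d y y = 0" by simp

lemma dist_eq_1_iff: "d y z = 1 \<longleftrightarrow> adj y z"
proof
  assume "d y z = 1" then show "adj y z" using path_dist[of y z] by (simp add: OO_def)
next
  assume a: "adj y z"
  have "d y z \<le> 1" using a by (intro gdist_le) (simp add: OO_def)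
  moreover have "d y z \<noteq> 0" using a by auto
  ultimately show "d y z = 1" by linarith
qed

lemma dist_adj: "adj y z \<Longrightarrow> d y z = 1" by (simp only: dist_eq_1_iff)

lemma adj_dist_le: assumes "adj y z" shows "d w y \<le> d w z + 1" "d w z \<le> d w y + 1"
  using dist_triangle[of w y z] dist_triangle[of w z y] dist_adj[OF assms] dist_commute[of y z] by auto

lemma closer_neighbour:
  assumes "d w y = Suc n"
  obtains z where "adj y z" "d w z = n"
proof -
  have "(adj ^^ Suc n) w y" using path_dist[of w y] assms by simp
  then obtain z where z: "(adj ^^ n) w z" "adj z y" by (auto elim: relpowp_Suc_E)
  then have "d w z \<le> n" "n \<le> d w z" using gdist_le[of n adj w z] adj_dist_le[of z y w] assms by auto
  with z that[of z] show thesis by (simp add: adj_sym)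
qed

lemma dist_le_diam: "d y z \<le> diam adj"
proof -
  have "d y z \<le> ecc adj y" unfolding ecc_def by (rule Max_ge) auto
  also have "\<dots> \<le> diam adj" unfolding diam_def by (rule Max_ge) auto
  finally show ?thesis .
qed

lemma intersection_number_card:
  "card {w. d y w = i \<and> d z w = j} = intersection_number adj (d y z) i j"
  unfolding intersection_number_def
proof (rule sym, rule the_equality)
  show "\<forall>u v. d u v = d y z \<longrightarrow> card {w. d u w = i \<and> d v w = j} = card {w. d y w = i \<and> d z w = j}"
    using regular unfolding distance_regular_def by blast
qed auto

text \<open>The number of vertices at distance \<open>i\<close> from \<open>y\<close> is an
  intersection number with upper index \<open>0\<close>, so it does not depend on \<open>y\<close>,
  and a single pair at distance \<open>i\<close> suffices. A geodesic between vertices at maximal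
  distance contains one.\<close>

lemma ex_at_dist:
  assumes "i \<le> diam adj"
  shows "\<exists>z. d y z = i"
proof -
  have "\<exists>u v. d u v = i"
  proof -
    have "diam adj \<in> range (ecc adj)" unfolding diam_def by (rule Max_in) auto
    then obtain u where u: "ecc adj u = diam adj" by auto
    have "ecc adj u \<in> range (d u)" unfolding ecc_def by (rule Max_in) auto
    then obtain v where v: "d u v = diam adj" using u by auto
    have "\<exists>w. d u w = diam adj - n" for n
    proof (induction n)
      case 0 then show ?case using v by auto
    next
      case (Suc n)
      then obtain w where w: "d u w = diam adj - n" by auto
      show ?case
      proof (cases "diam adj - n")
        case 0 then show ?thesis using w by (intro exI[of _ w]) simp
      next
        case (Suc m)
        then obtain z where "d u z = m" using closer_neighbour w by metis
        then show ?thesis using Suc by (intro exI[of _ z]) simp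
      qed
    qed
    from this[of "diam adj - i"] assms show ?thesis by auto
  qed
  then obtain u v where uv: "d u v = i" by blast
  have "card {w. d y w = i \<and> d y w = i} = card {w. d u w = i \<and> d u w = i}"
    unfolding intersection_number_card by simp
  moreover have "v \<in> {w. d u w = i}" using uv by simp
  then have "card {w. d u w = i} \<noteq> 0" by auto
  ultimately have "card {w. d y w = i} \<noteq> 0" by simp
  then show ?thesis by (auto simp: card_eq_0_iff)
qed

lemma ecc_eq_diam: "ecc adj y = diam adj"
proof -
  obtain z where z: "d y z = diam adj" using ex_at_dist by blast
  show ?thesis unfolding ecc_def
  proof (rule Max_eqI)
    show "diam adj \<in> range (d y)" using z by (metis rangeI)
    show "m \<le> diam adj" if "m \<in> range (d y)" for m using that dist_le_diam by blast
  qed simp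
qed

section \<open>Neighbours of a vertex, sorted by distance from a second vertex\<close>

lemma card_c: "card {w. adj y w \<and> Suc (d z w) = d y z} = c_num adj (d y z)"
proof (cases "d y z")
  \<comment> \<open>Subtraction truncates: \<open>c_num adj 0\<close> uses the index
    \<open>0 - 1 = 0\<close>, so it counts vertices that are at once adjacent and equal to the same
    vertex, and is zero.\<close>
  case 0
  then have "c_num adj (d y z) = card {w. d y w = 1 \<and> d z w = 0}"
    unfolding c_num_def intersection_number_card[symmetric] by simp
  also have "{w. d y w = 1 \<and> d z w = 0} = {}" using 0 by auto
  finally show ?thesis using 0 by simp
next
  case (Suc n)
  then have "{w. adj y w \<and> Suc (d z w) = d y z} = {w. d y w = 1 \<and> d z w = d y z - 1}"
    unfolding dist_eq_1_iff by auto
  then show ?thesis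
    unfolding c_num_def intersection_number_card[symmetric] by simp
qed

lemma card_a: "card {w. adj y w \<and> d z w = d y z} = a_num adj (d y z)"
  unfolding a_num_def intersection_number_card[symmetric] dist_eq_1_iff ..

lemma card_b: "card {w. adj y w \<and> d z w = Suc (d y z)} = b_num adj (d y z)"
  unfolding b_num_def intersection_number_card[symmetric] dist_eq_1_iff by simp

text \<open>This makes adjacency a three-term operator on functions of the distance from
  \<open>z\<close>. At distance zero the value \<open>\<phi> (- 1)\<close> enters with the
  coefficient \<open>c_num adj 0\<close>, which is zero.\<close>

lemma sum_neighbours:
  fixes \<phi> :: "int \<Rightarrow> real"
  shows "(\<Sum>w | adj y w. \<phi> (int (d z w))) = real (c_num adj (d y z)) * \<phi> (int (d y z) - 1)
     + real (a_num adj (d y z)) * \<phi> (int (d y z)) + real (b_num adj (d y z)) * \<phi> (int (d y z) + 1)"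
proof -
  let ?C = "{w. adj y w \<and> Suc (d z w) = d y z}" and ?A = "{w. adj y w \<and> d z w = d y z}"
    and ?B = "{w. adj y w \<and> d z w = Suc (d y z)}"
  have "{w. adj y w} = ?C \<union> ?A \<union> ?B"
    using adj_dist_le[of y _ z] dist_commute[of y z] by (fastforce simp: le_Suc_eq)
  then have "(\<Sum>w | adj y w. \<phi> (int (d z w))) = (\<Sum>w\<in>?C \<union> ?A \<union> ?B. \<phi> (int (d z w)))" by simp
  also have "\<dots> = (\<Sum>w\<in>?C. \<phi> (int (d z w))) + (\<Sum>w\<in>?A. \<phi> (int (d z w))) + (\<Sum>w\<in>?B. \<phi> (int (d z w)))"
    by (subst sum.union_disjoint; (subst sum.union_disjoint)?) auto
  also have "(\<Sum>w\<in>?C. \<phi> (int (d z w))) = (\<Sum>w\<in>?C. \<phi> (int (d y z) - 1))"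
    by (rule sum.cong) (auto intro: arg_cong[where f=\<phi>])
  also have "(\<Sum>w\<in>?A. \<phi> (int (d z w))) = (\<Sum>w\<in>?A. \<phi> (int (d y z)))"
    by (rule sum.cong) auto
  also have "(\<Sum>w\<in>?B. \<phi> (int (d z w))) = (\<Sum>w\<in>?B. \<phi> (int (d y z) + 1))"
    by (rule sum.cong) (auto simp: add.commute)
  finally show ?thesis by (simp add: card_a card_b card_c)
qed

lemma valency:
  "real (c_num adj (d y z)) + real (a_num adj (d y z)) + real (b_num adj (d y z)) = real (b_num adj 0)"
proof -
  have "real (card {w. adj y w}) = real (c_num adj (d y z)) + real (a_num adj (d y z)) + real (b_num adj (d y z))"
    using sum_neighbours[of "\<lambda>_. 1" z y] by simp
  moreover have "card {w. adj y w} = b_num adj 0"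
  proof -
    have "{w. adj y w} = {w. adj y w \<and> d y w = Suc (d y y)}" by (auto simp: dist_adj)
    then show ?thesis using card_b[of y y] by simp
  qed
  ultimately show ?thesis by simp
qed

lemma c_pos:
  assumes "0 < i" "i \<le> diam adj"
  shows "0 < c_num adj i"
proof -
  obtain y z :: 'a where yz: "d z y = i" using ex_at_dist assms by metis
  then obtain n where n: "i = Suc n" using assms by (cases i) auto
  then obtain w where w: "adj y w" "d z w = n" using closer_neighbour yz by metis
  have "w \<in> {w. adj y w \<and> Suc (d z w) = d y z}" using w n yz by (simp add: dist_commute[of y z])
  then have "card {w. adj y w \<and> Suc (d z w) = d y z} \<noteq> 0"
    by (metis card_eq_0_iff empty_iff finite)
  then show ?thesis unfolding card_c using yz dist_commute[of y z] by simp
qed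

lemma b_pos:
  assumes "i < diam adj"
  shows "0 < b_num adj i"
proof -
  obtain u z :: 'a where uz: "d z u = Suc i" using ex_at_dist[of "Suc i"] assms by (metis Suc_leI)
  then obtain y where y: "adj u y" "d z y = i" using closer_neighbour by metis
  have "u \<in> {w. adj y w \<and> d z w = Suc (d y z)}" using y uz by (simp add: dist_commute[of y z] adj_sym)
  then have "card {w. adj y w \<and> d z w = Suc (d y z)} \<noteq> 0"
    by (metis card_eq_0_iff empty_iff finite)
  then show ?thesis unfolding card_b using y dist_commute[of y z] by simp
qed

lemma b_diam: "b_num adj (diam adj) = 0"
proof -
  obtain y z :: 'a where yz: "d y z = diam adj" using ex_at_dist by blast
  have "d z w \<noteq> Suc (d y z)" for w using dist_le_diam[of z w] yz by auto
  then have "{w. adj y w \<and> d z w = Suc (d y z)} = {}" by auto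
  then have "card {w. adj y w \<and> d z w = Suc (d y z)} = 0" by (simp only: card.empty)
  then show ?thesis unfolding card_b using yz by simp
qed

lemma c_0: "c_num adj 0 = 0"
  using card_c[of undefined undefined] by simp

end

section \<open>The tridiagonal relation\<close>

locale classical_graph = distance_regular_graph adj
  for adj :: "'a::finite \<Rightarrow> 'a \<Rightarrow> bool" +
  fixes q \<alpha> \<beta> :: real
  assumes classical: "has_classical_parameters adj (diam adj) q \<alpha> \<beta>"
    and q_less: "q < -1"
begin

section \<open>Classical parameters and the action on radial vectors\<close>

lemma q_bracket_eq: "q_bracket q j = (q ^ j - 1) / (q - 1)"
  unfolding q_bracket_def using geometric_sum[of q j] q_less by simp

definition N :: "'a \<Rightarrow> 'a \<Rightarrow> real" where
  "N y z = q powi (- int (d y z))"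

definition M :: "real^'a^'a" where
  "M = (\<chi> y z. of_bool (adj y z))"

lemma M_entry [simp]: "M $ y $ z = of_bool (adj y z)"
  by (simp add: M_def)

text \<open>The vectors \<open>radial a \<phi>\<close> form the primary module of the Terwilliger algebra with respect to \<open>a\<close>.\<close>

definition radial :: "'a \<Rightarrow> (int \<Rightarrow> real) \<Rightarrow> real^'a" where
  "radial a \<phi> = (\<chi> u. \<phi> (int (d a u)))"

lemma radial_entry [simp]: "radial a \<phi> $ u = \<phi> (int (d a u))"
  by (simp add: radial_def)

text \<open>Both classical formulas are quadratic in powers of \<open>q\<close>, with leading
  coefficients \<open>r * s / q\<close> and \<open>r * s\<close>, the ratio that
  \<open>askey_wilson_quadratic\<close> requires. The formula for \<open>c\<close> vanishes at
  \<open>0\<close> and that for \<open>b\<close> at the diameter, in agreement with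
  \<open>c_0\<close> and \<open>b_diam\<close>.\<close>

lemma recurrence:
  obtains C A B \<gamma> \<rho> \<omega> \<eta> \<theta> \<kappa> where
    "\<And>i. i \<le> diam adj \<Longrightarrow> C (int i) = real (c_num adj i) \<and> B (int i) = real (b_num adj i) \<and>
        A (int i) = real (b_num adj 0) - real (b_num adj i) - real (c_num adj i)"
    and "askey_wilson q \<gamma> \<rho> \<omega> \<eta> C A B"
    and "\<And>h. three_term C A B (\<lambda>h. q powi (- h)) h = \<theta> * q powi (- h) + \<kappa>"
proof -
  define r where "r = 1 / (q - 1)"
  define s where "s = \<alpha> * r"
  define S where "S = q ^ diam adj"
  have q0: "q \<noteq> 0" "q - 1 \<noteq> 0" using q_less by auto
  let ?t = "\<lambda>h::int. q powi h"
  let ?C = "\<lambda>h. (r * s / q) * (?t h)\<^sup>2 + (r * (1 - s - s / q)) * ?t h + (- r * (1 - s))"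
  let ?B = "\<lambda>h. q * (r * s / q) * (?t h)\<^sup>2 + (- r * (\<beta> + s + s * S)) * ?t h + r * S * (\<beta> + s)"
  let ?A = "\<lambda>h. real (b_num adj 0) - ?B h - ?C h"
  have br: "q_bracket q j = r * (q ^ j - 1)" for j by (simp add: q_bracket_eq r_def)
  have C: "?C (int i) = real (c_num adj i)" if "i \<le> diam adj" for i
  proof (cases i)
    case 0
    then show ?thesis using c_0 by (simp add: algebra_simps)
  next
    case (Suc n)
    then have "real (c_num adj i) = r * (q ^ i - 1) * (1 + s * (q ^ n - 1))"
      using classical that by (simp add: has_classical_parameters_def br s_def)
    also have "q ^ n = q ^ i / q" using Suc q0 by simp
    finally show ?thesis
      by (simp add: algebra_simps power2_eq_square add_divide_distrib diff_divide_distrib)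
  qed
  have B: "?B (int i) = real (b_num adj i)" if "i \<le> diam adj" for i
  proof -
    have "real (b_num adj i) = (r * (S - 1) - r * (q ^ i - 1)) * (\<beta> - s * (q ^ i - 1))"
    proof (cases "i = diam adj")
      case True
      then show ?thesis using b_diam by (simp add: S_def)
    next
      case False
      then show ?thesis using that classical by (simp add: has_classical_parameters_def br s_def S_def)
    qed
    then show ?thesis using q0 by (simp add: algebra_simps power2_eq_square)
  qed
  obtain \<gamma> \<rho> \<omega> \<eta> where AW: "askey_wilson q \<gamma> \<rho> \<omega> \<eta> ?C ?A ?B"
    using askey_wilson_quadratic(1)[OF q0(1)] by blast
  obtain \<theta> \<kappa> where eig: "\<And>h. three_term ?C ?A ?B (\<lambda>h. q powi (- h)) h = \<theta> * q powi (- h) + \<kappa>"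
    using askey_wilson_quadratic(2)[OF q0(1)] by blast
  show ?thesis
  proof (rule that[OF _ AW eig])
    fix i assume i: "i \<le> diam adj"
    show "?C (int i) = real (c_num adj i) \<and> ?B (int i) = real (b_num adj i) \<and>
        ?A (int i) = real (b_num adj 0) - real (b_num adj i) - real (c_num adj i)"
      by (simp only: C[OF i] B[OF i] simp_thms)
  qed
qed


lemma mult_radial:
  assumes "\<And>i. i \<le> diam adj \<Longrightarrow> C (int i) = real (c_num adj i) \<and> B (int i) = real (b_num adj i) \<and>
        A (int i) = real (b_num adj 0) - real (b_num adj i) - real (c_num adj i)"
  shows "M *v radial a \<phi> = radial a (three_term C A B \<phi>)"
proof -
  have "(M *v radial a \<phi>) $ u = (\<Sum>w | adj u w. \<phi> (int (d a w)))" for u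
    by (simp add: matrix_vector_mult_def of_bool_def if_distrib[where f="\<lambda>t. t * _"] sum.If_cases
        cong: if_cong)
  moreover have "A (int i) = real (a_num adj i)" if i: "i \<le> diam adj" for i
  proof -
    obtain v u where "d v u = i" using ex_at_dist[OF i] by blast
    then show ?thesis using assms[OF i] valency[of v u] by simp
  qed
  ultimately show ?thesis
    unfolding sum_neighbours
    by (simp add: Finite_Cartesian_Product.vec_eq_iff three_term_def assms dist_le_diam dist_commute)
qed

lemma diag_mult_radial: "diag_matrix (N a) *v radial a \<phi> = radial a (\<lambda>h. q powi (- h) * \<phi> h)"
  by (simp add: Finite_Cartesian_Product.vec_eq_iff diag_matrix_mult_vec N_def)

text \<open>By \<open>eig\<close> and regularity, the span of \<open>N\<close> and the all-ones
  matrix is closed under multiplication by the adjacency matrix. The three-term recurrence of the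
  distance matrices then puts the product of each of them with \<open>N\<close> into this span, and
  \<open>N\<close> itself is a combination of distance matrices.\<close>

lemma sum_N_N:
  assumes eig: "\<And>y b. (\<Sum>w | adj y w. N w b) = \<theta> * N y b + \<kappa>"
  shows "\<exists>\<kappa> \<mu>. \<forall>a b. (\<Sum>z\<in>UNIV. N z a * N z b) = \<kappa> * N a b + \<mu>"
proof -
  define Q where "Q f \<longleftrightarrow> (\<exists>v \<kappa>. \<forall>y b. f y b = v * N y b + \<kappa>)" for f :: "'a \<Rightarrow> 'a \<Rightarrow> real"
  have Q_add: "Q (\<lambda>y b. f y b + g y b)" if "Q f" "Q g" for f g
  proof -
    from that obtain v k v' k' where "\<forall>y b. f y b = v * N y b + k" "\<forall>y b. g y b = v' * N y b + k'"
      unfolding Q_def by blast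
    then show ?thesis unfolding Q_def
      by (intro exI[of _ "v + v'"] exI[of _ "k + k'"]) (simp add: algebra_simps)
  qed
  have Q_mult: "Q (\<lambda>y b. s * f y b)" if "Q f" for f s
  proof -
    from that obtain v k where "\<forall>y b. f y b = v * N y b + k" unfolding Q_def by blast
    then show ?thesis unfolding Q_def
      by (intro exI[of _ "s * v"] exI[of _ "s * k"]) (simp add: algebra_simps)
  qed
  have Q_sum: "Q (\<lambda>y b. \<Sum>i\<in>I. f i y b)" if "finite I" "\<And>i. i \<in> I \<Longrightarrow> Q (f i)"
    for f and I :: "nat set"
    using that
  proof (induction I rule: finite_induct)
    case empty
    show ?case unfolding Q_def by (intro exI[of _ 0]) simp
  next
    case (insert i I)
    then show ?case using Q_add[of "f i" "\<lambda>y b. \<Sum>i\<in>I. f i y b"] by simp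
  qed
  have Q_adj: "Q (\<lambda>y b. \<Sum>w | adj y w. f w b)" if "Q f" for f
  proof -
    from that obtain v k where f: "\<forall>y b. f y b = v * N y b + k" unfolding Q_def by blast
    have "card {w. adj y w} = b_num adj 0" for y
      using card_b[of y y] by (simp add: dist_adj cong: conj_cong)
    then have "(\<Sum>w | adj y w. f w b) = v * \<theta> * N y b + (v * \<kappa> + real (b_num adj 0) * k)" for y b
      using eig[where y=y and b=b] by (simp add: f sum.distrib sum_distrib_left[symmetric] algebra_simps)
    then show ?thesis unfolding Q_def by blast
  qed
  \<comment> \<open>\<open>S j\<close> is the \<open>j\<close>-th distance matrix times
    \<open>N\<close>. As \<open>j\<close> is an integer, \<open>S (- 1)\<close> exists and is zero,
    so the truncated index \<open>i - 1\<close> below does no harm at \<open>i = 0\<close>.\<close>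
  define S where "S j y b = (\<Sum>z\<in>UNIV. of_bool (int (d y z) = j) * N z b)" for j y b
  have "(\<Sum>w | adj y w. S (int i) w b) = real (c_num adj (Suc i)) * S (int i + 1) y b
      + real (a_num adj i) * S (int i) y b + real (b_num adj (i - 1)) * S (int i - 1) y b" for i y b
  proof -
    have e: "int m = int i + 1 \<Longrightarrow> m = Suc i" "int m = int i - 1 \<Longrightarrow> m = i - 1" for m
      by auto
    have "(\<Sum>w | adj y w. S (int i) w b)
        = (\<Sum>z\<in>UNIV. (\<Sum>w | adj y w. of_bool (int (d z w) = int i)) * N z b)"
      unfolding S_def by (subst sum.swap) (simp add: sum_distrib_right dist_commute)
    also have "\<dots> = (\<Sum>z\<in>UNIV. (real (c_num adj (Suc i)) * of_bool (int (d y z) = int i + 1)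
        + real (a_num adj i) * of_bool (int (d y z) = int i)
        + real (b_num adj (i - 1)) * of_bool (int (d y z) = int i - 1)) * N z b)"
      by (subst sum_neighbours[where \<phi>="\<lambda>h. of_bool (h = int i)"], rule sum.cong)
         (auto simp: of_bool_def dest: e)
    finally show ?thesis
      unfolding S_def by (simp only: sum.distrib sum_distrib_left distrib_right mult.assoc)
  qed
  note rec = this
  have QS: "Q (S (int n - 1)) \<and> Q (S (int n))" if "n \<le> diam adj" for n
    using that
  proof (induction n)
    case 0
    have "S (- 1) y b = 0 * N y b + 0" "S 0 y b = 1 * N y b + 0" for y b
      by (simp_all add: S_def of_bool_def if_distrib[where f="\<lambda>t. t * _"] cong: if_cong)
    then show ?case unfolding Q_def by (metis int_ops(1) diff_0)
  next
    case (Suc n)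
    let ?c = "real (c_num adj (Suc n))"
    have "?c \<noteq> 0" using c_pos[of "Suc n"] Suc.prems by simp
    then have "S (int (Suc n)) = (\<lambda>y b. (1 / ?c) * ((\<Sum>w | adj y w. S (int n) w b)
        + ((- real (a_num adj n)) * S (int n) y b + (- real (b_num adj (n - 1))) * S (int n - 1) y b)))"
      unfolding rec by (simp add: fun_eq_iff add.commute)
    moreover have "Q \<dots>"
      using Suc by (intro Q_mult Q_add Q_adj) simp_all
    ultimately have "Q (S (int (Suc n)))" by simp
    then show ?case using Suc by simp
  qed
  have "Q (\<lambda>a b. \<Sum>i\<le>diam adj. q powi (- int i) * S (int i) a b)"
    by (intro Q_sum Q_mult) (use QS in auto)
  moreover have "(\<Sum>i\<le>diam adj. q powi (- int i) * S (int i) a b) = (\<Sum>z\<in>UNIV. N z a * N z b)" for a b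
  proof -
    have "(\<Sum>i\<le>diam adj. q powi (- int i) * S (int i) a b)
        = (\<Sum>z\<in>UNIV. \<Sum>i\<le>diam adj. q powi (- int i) * (of_bool (d a z = i) * N z b))"
      unfolding S_def by (subst sum.swap) (simp only: sum_distrib_left of_nat_eq_iff)
    also have "\<dots> = (\<Sum>z\<in>UNIV. N z a * N z b)"
    proof (rule sum.cong[OF refl])
      fix z
      have "(\<Sum>i\<le>diam adj. q powi (- int i) * (of_bool (d a z = i) * N z b))
          = (\<Sum>i\<le>diam adj. if d a z = i then q powi (- int i) * N z b else 0)"
        by (rule sum.cong) auto
      then show "(\<Sum>i\<le>diam adj. q powi (- int i) * (of_bool (d a z = i) * N z b)) = N z a * N z b"
        by (simp add: dist_le_diam N_def dist_commute)
    qed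
    finally show ?thesis .
  qed
  ultimately show ?thesis unfolding Q_def by simp
qed

text \<open>The left-hand side of Terwilliger's tridiagonal relation. The diagonal matrix is left as
  an argument because the proof needs a linear map on all matrices that can be applied
  twice.\<close>

definition TD :: "real \<Rightarrow> real \<Rightarrow> real^'a^'a \<Rightarrow> real^'a^'a" where
  "TD \<gamma> \<rho> Z = (let P = M ** (M ** Z) - (q + 1 / q) *\<^sub>R (M ** (Z ** M)) + (Z ** M) ** M
       - \<gamma> *\<^sub>R (M ** Z + Z ** M) - \<rho> *\<^sub>R Z in M ** P - P ** M)"

lemma tridiagonal_relation: "\<exists>\<gamma> \<rho>. \<forall>z. TD \<gamma> \<rho> (diag_matrix (N z)) = 0"
proof -
  obtain C A B \<gamma> \<rho> \<omega> \<eta> \<theta> \<kappa> where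
    coeffs: "\<And>i. i \<le> diam adj \<Longrightarrow> C (int i) = real (c_num adj i) \<and> B (int i) = real (b_num adj i) \<and>
        A (int i) = real (b_num adj 0) - real (b_num adj i) - real (c_num adj i)"
    and AW: "askey_wilson q \<gamma> \<rho> \<omega> \<eta> C A B"
    and eig: "\<And>h. three_term C A B (\<lambda>h. q powi (- h)) h = \<theta> * q powi (- h) + \<kappa>"
    by (rule recurrence) (rule that)
  note mr = mult_radial[OF coeffs]
  have "(\<Sum>w | adj y w. N w b) = \<theta> * N y b + \<kappa>" for y b
  proof -
    have "(\<Sum>w | adj y w. N w b) = (M *v radial b (\<lambda>h. q powi (- h))) $ y"
      by (simp add: matrix_vector_mult_def of_bool_def if_distrib[where f="\<lambda>t. t * _"] sum.If_cases
          N_def dist_commute cong: if_cong)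
    then show ?thesis by (simp add: mr eig N_def dist_commute)
  qed
  then obtain \<nu> \<mu> where N2: "\<And>a b. (\<Sum>z\<in>UNIV. N z a * N z b) = \<nu> * N a b + \<mu>"
    using sum_N_N by blast
  let ?P = "\<lambda>Z. M ** (M ** Z) - (q + 1 / q) *\<^sub>R (M ** (Z ** M)) + (Z ** M) ** M
       - \<gamma> *\<^sub>R (M ** Z + Z ** M) - \<rho> *\<^sub>R Z"
  have TD: "TD \<gamma> \<rho> = (\<lambda>Z. M ** ?P Z - ?P Z ** M)" by (simp add: TD_def Let_def fun_eq_iff)
  have Msym: "M $ i $ j = M $ j $ i" for i j by (simp add: adj_commute)
  note sc = selfadjoint_cubic_commutator[OF matrix_mult_linear_left[of M] matrix_mult_linear_right[of M]
      matrix_mul_assoc[symmetric] inner_symmetric_mult_left[OF Msym] inner_symmetric_mult_right[OF Msym],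
      where \<beta>="q + 1 / q" and \<gamma>=\<gamma> and \<rho>=\<rho>]
  have T: "linear (TD \<gamma> \<rho>)" and self: "\<And>Z W. inner (TD \<gamma> \<rho> Z) W = inner Z (TD \<gamma> \<rho> W)"
    unfolding TD by (rule sc)+
  note expand = matrix_vector_mult_diff_rdistrib matrix_vector_mult_add_rdistrib
    scaleR_matrix_vector_assoc[symmetric] matrix_vector_mul_assoc[symmetric]
  \<comment> \<open>\<open>M\<close> maps radial vectors to radial vectors, so in each term of
    \<open>TD\<close> the matrix \<open>W\<close> meets a radial vector.\<close>
  have kill_TD: "TD \<gamma> \<rho> W *v radial a \<phi> = 0" if "\<And>\<phi>. W *v radial a \<phi> = 0" for W a \<phi>
    unfolding TD by (simp add: expand mr that)
  have kill_N: "TD \<gamma> \<rho> (diag_matrix (N a)) *v radial a \<phi> = 0" for a \<phi>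
  proof -
    \<comment> \<open>By the Askey-Wilson relation the inner expression acts on radial vectors as a
      polynomial in \<open>M\<close>; hence it commutes with \<open>M\<close> there.\<close>
    have P: "?P (diag_matrix (N a)) *v radial a \<psi> = \<omega> *\<^sub>R (M *v radial a \<psi>) + \<eta> *\<^sub>R radial a \<psi>" for \<psi>
      by (simp only: expand mr diag_mult_radial) (simp only: Finite_Cartesian_Product.vec_eq_iff
          radial_entry vector_add_component vector_minus_component vector_scaleR_component
          real_scaleR_def AW[unfolded askey_wilson_def Let_def, rule_format] simp_thms)
    have "TD \<gamma> \<rho> (diag_matrix (N a)) *v radial a \<phi>
        = M *v (?P (diag_matrix (N a)) *v radial a \<phi>) - ?P (diag_matrix (N a)) *v (M *v radial a \<phi>)"
      unfolding TD by (subst matrix_vector_mult_diff_rdistrib) (simp only: matrix_vector_mul_assoc)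
    also have "\<dots> = 0"
      by (simp only: P mr matrix_vector_right_distrib matrix_vector_mult_scaleR diff_self)
    finally show ?thesis .
  qed
  have "TD \<gamma> \<rho> (TD \<gamma> \<rho> (diag_matrix (N a))) $ a $ a = 0" for a
  proof -
    \<comment> \<open>The unit vector at \<open>a\<close> is radial, so the diagonal entry at
      \<open>a\<close> can be read off from the action on radial vectors.\<close>
    have "axis a 1 = radial a (\<lambda>h. of_bool (h = 0))"
      by (auto simp: Finite_Cartesian_Product.vec_eq_iff axis_def)
    then have "TD \<gamma> \<rho> (TD \<gamma> \<rho> (diag_matrix (N a))) *v axis a 1 = 0"
      using kill_TD[OF kill_N] by simp
    then show ?thesis
      by (metis matrix_vector_mult_basis column_def vec_lambda_beta zero_index)
  qed
  moreover have "diag_matrix (\<lambda>_. 1) = (Finite_Cartesian_Product.mat 1 :: real^'a^'a)"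
    by (simp add: Finite_Cartesian_Product.vec_eq_iff Finite_Cartesian_Product.mat_def)
  then have "TD \<gamma> \<rho> (diag_matrix (\<lambda>_. 1)) = 0"
    unfolding TD
    by (simp only: matrix_mul_lid matrix_mul_rid matrix_mul_assoc diff_self
        linear_add[OF matrix_mult_linear_left[of M]]
        linear_diff[OF matrix_mult_linear_left[of M]] linear_cmul[OF matrix_mult_linear_left[of M]]
        linear_add[OF matrix_mult_linear_right[of M]]
        linear_diff[OF matrix_mult_linear_right[of M]] linear_cmul[OF matrix_mult_linear_right[of M]])
  ultimately have "TD \<gamma> \<rho> (diag_matrix (N z)) = 0" for z
    using selfadjoint_zero_on_diagonals[OF T self _ N2] by blast
  then show ?thesis by blast
qed

end

section \<open>The balanced set condition\<close>

context classical_graph begin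

text \<open>The number of walks of length \<open>n\<close> between vertices at distance
  \<open>h\<close>. The argument \<open>h\<close> is an integer so that \<open>h - 1\<close> is not
  truncated at \<open>h = 0\<close>, where its coefficient \<open>c_num adj 0\<close>
  vanishes.\<close>

primrec walks :: "nat \<Rightarrow> int \<Rightarrow> real" where
  "walks 0 h = of_bool (h = 0)"
| "walks (Suc n) h = real (c_num adj (nat h)) * walks n (h - 1) + real (a_num adj (nat h)) * walks n h
     + real (b_num adj (nat h)) * walks n (h + 1)"

primrec M_pow :: "nat \<Rightarrow> real^'a^'a" where
  "M_pow 0 = Finite_Cartesian_Product.mat 1"
| "M_pow (Suc n) = M ** M_pow n"

lemma M_pow_entry: "M_pow n $ x $ y = walks n (int (d x y))"
proof (induction n arbitrary: x)
  case 0
  then show ?case by (simp add: Finite_Cartesian_Product.mat_def)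
next
  case (Suc n)
  have "M_pow (Suc n) $ x $ y = (\<Sum>w | adj x w. walks n (int (d y w)))"
    by (simp add: matrix_matrix_mult_def Suc of_bool_def if_distrib[where f="\<lambda>t. t * _"] sum.If_cases
        dist_commute cong: if_cong)
  then show ?case by (simp add: sum_neighbours)
qed

lemma M_pow_diag: "(M_pow n ** diag_matrix f ** M_pow m) $ x $ y
    = (\<Sum>w\<in>UNIV. M_pow n $ x $ w * f w * M_pow m $ w $ y)"
  by (simp add: matrix_matrix_mult_def if_distrib[where f="\<lambda>t. _ * t"] cong: if_cong)

lemma M_pow_diag_0_right: "(M_pow n ** diag_matrix f ** M_pow 0) $ x $ y = walks n (int (d x y)) * f y"
  unfolding M_pow_diag M_pow_entry by simp

lemma M_pow_diag_0_left: "(M_pow 0 ** diag_matrix f ** M_pow n) $ x $ y = walks n (int (d x y)) * f x"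
  unfolding M_pow_diag M_pow_entry by (simp add: of_bool_def if_distrib[where f="\<lambda>t. t * _"] cong: if_cong)

lemma M_pow_diag_1_right:
  "(M_pow n ** diag_matrix f ** M_pow 1) $ x $ y = (\<Sum>w | adj y w. walks n (int (d x w)) * f w)"
proof -
  have "(M_pow n ** diag_matrix f ** M_pow 1) $ x $ y
      = (\<Sum>w\<in>UNIV. if adj y w then walks n (int (d x w)) * f w else 0)"
    unfolding M_pow_diag M_pow_entry[of n] by (rule sum.cong) (auto simp: adj_commute)
  then show ?thesis by (simp add: sum.If_cases)
qed

lemma M_pow_diag_1_left:
  "(M_pow 1 ** diag_matrix f ** M_pow n) $ x $ y = (\<Sum>w | adj x w. walks n (int (d y w)) * f w)"
proof -
  have "(M_pow 1 ** diag_matrix f ** M_pow n) $ x $ y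
      = (\<Sum>w\<in>UNIV. if adj x w then walks n (int (d y w)) * f w else 0)"
    unfolding M_pow_diag M_pow_entry[of n] by (rule sum.cong) (auto simp: dist_commute)
  then show ?thesis by (simp add: sum.If_cases)
qed

text \<open>The first identity is \<open>TD\<close> expanded, the second its anticommutator with
  \<open>M\<close>. In the latter \<open>G 2 2\<close> and \<open>G 1 1\<close> cancel, so every
  remaining term has an exponent at most one and its \<open>(x, y)\<close> entry involves only
  \<open>x\<close>, \<open>y\<close> and their neighbours.\<close>

lemma tridiagonal_M_pow:
  fixes Z :: "real^'a^'a"
  assumes "TD \<gamma> \<rho> Z = 0"
  defines "G \<equiv> \<lambda>n m. M_pow n ** Z ** M_pow m"
  shows "(G 3 0 - G 0 3) - (q + 1 / q + 1) *\<^sub>R (G 2 1 - G 1 2) - \<gamma> *\<^sub>R (G 2 0 - G 0 2) - \<rho> *\<^sub>R (G 1 0 - G 0 1) = 0"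
      (is "?E1 = 0")
    and "(G 4 0 - G 0 4) - (q + 1 / q) *\<^sub>R (G 3 1 - G 1 3) - \<gamma> *\<^sub>R (G 3 0 - G 0 3)
      - \<gamma> *\<^sub>R (G 2 1 - G 1 2) - \<rho> *\<^sub>R (G 2 0 - G 0 2) = 0" (is "?E2 = 0")
proof -
  note lin = linear_add[OF matrix_mult_linear_left] linear_diff[OF matrix_mult_linear_left]
    linear_cmul[OF matrix_mult_linear_left] linear_add[OF matrix_mult_linear_right]
    linear_diff[OF matrix_mult_linear_right] linear_cmul[OF matrix_mult_linear_right]
  have pow: "M_pow 1 = M" "M_pow 2 = M ** M" "M_pow 3 = M ** M ** M" "M_pow 4 = M ** M ** M ** M"
    by (simp_all add: numeral_eq_Suc matrix_mul_assoc)
  have TD: "TD \<gamma> \<rho> Z = ?E1"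
    unfolding TD_def Let_def G_def pow M_pow.simps(1)
    by (simp only: matrix_mul_lid matrix_mul_rid matrix_mul_assoc lin)
       (simp only: scaleR_add_left scaleR_diff_right scaleR_add_right scaleR_one algebra_simps)
  show E1: "?E1 = 0" using TD assms by simp
  have "?E2 = M ** TD \<gamma> \<rho> Z + TD \<gamma> \<rho> Z ** M"
    unfolding TD G_def pow M_pow.simps(1)
    by (simp only: matrix_mul_lid matrix_mul_rid matrix_mul_assoc lin)
       (simp only: scaleR_add_left scaleR_diff_right scaleR_add_right scaleR_one algebra_simps)
  then show "?E2 = 0"
    using assms(1) by (simp add: linear_0[OF matrix_mult_linear_left] linear_0[OF matrix_mult_linear_right])
qed

text \<open>Read both tridiagonal identities at the entry \<open>(x, y)\<close>. The sums over
  common neighbours cancel by symmetry; the first identity then makes the distance-two difference a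
  multiple of \<open>N z y - N z x\<close>, and the second does the same for distance three. The
  factor does not depend on \<open>z\<close>.\<close>

lemma balanced:
  assumes diam: "3 \<le> diam adj" and xy: "d x y = 2"
  shows "(\<Sum>w | adj y w \<and> d x w = 3. N z w) - (\<Sum>w | adj x w \<and> d y w = 3. N z w)
       = real (b_num adj 2) / q * (N z y - N z x)"
proof -
  define S where "S x y z j = (\<Sum>w | adj y w \<and> d x w = j. N z w)" for x y z j
  have S: "(\<Sum>w | adj y w. walks n (int (d x w)) * N z w)
      = walks n 1 * S x y z 1 + walks n 2 * S x y z 2 + walks n 3 * S x y z 3" if "d x y = 2" for x y z n
  proof -
    have "{w. adj y w} = {w. adj y w \<and> d x w = 1} \<union> {w. adj y w \<and> d x w = 2} \<union> {w. adj y w \<and> d x w = 3}"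
      using adj_dist_le[of y _ x] that by fastforce
    then have "(\<Sum>w | adj y w. walks n (int (d x w)) * N z w)
       = (\<Sum>w\<in>{w. adj y w \<and> d x w = 1} \<union> {w. adj y w \<and> d x w = 2} \<union> {w. adj y w \<and> d x w = 3}.
            walks n (int (d x w)) * N z w)" by simp
    also have "\<dots> = (\<Sum>w | adj y w \<and> d x w = 1. walks n (int (d x w)) * N z w)
       + (\<Sum>w | adj y w \<and> d x w = 2. walks n (int (d x w)) * N z w)
       + (\<Sum>w | adj y w \<and> d x w = 3. walks n (int (d x w)) * N z w)"
      by (subst sum.union_disjoint; (subst sum.union_disjoint)?) auto
    finally show ?thesis unfolding S_def sum_distrib_left by simp
  qed
  have yx: "d y x = 2" using xy by (simp add: dist_commute)
  have S1: "S x y z 1 = S y x z 1" for z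
    unfolding S_def by (rule sum.cong) (simp_all only: dist_eq_1_iff conj_commute)
  define f where "f n = walks n 2" for n
  \<comment> \<open>No walk of length two joins vertices at distance three, so the first identity
    does not see the sums for distance three. The other two facts allow division.\<close>
  have w23: "walks 2 3 = 0" and w22: "walks 2 2 \<noteq> 0" and w33: "walks 3 3 \<noteq> 0"
    using c_pos[of 1] c_pos[of 2] c_pos[of 3] diam by (simp_all add: numeral_eq_Suc)
  obtain \<gamma> \<rho> where TD: "\<And>z. TD \<gamma> \<rho> (diag_matrix (N z)) = 0"
    using tridiagonal_relation by blast
  let ?\<Delta> = "\<lambda>z. N z y - N z x"
  have div: "s = r / t * u" if "t * s = r * u" "t \<noteq> 0" for r s t u :: real
    using that by (simp add: field_simps)
  have "1 / q < 0" using q_less by simp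
  then have b1: "q + 1 / q + 1 \<noteq> 0" and b0: "q + 1 / q \<noteq> 0"
    using q_less by linarith+
  have "\<exists>r. \<forall>z. S x y z 2 - S y x z 2 = r * ?\<Delta> z"
  proof (rule exI, rule allI)
    fix z
    have "(f 3 - \<gamma> * f 2 - \<rho> * f 1) * ?\<Delta> z - (q + 1 / q + 1) * (f 2 * (S x y z 2 - S y x z 2)) = 0"
      using arg_cong[OF tridiagonal_M_pow(1)[OF TD[of z]], of "\<lambda>X. X $ x $ y"]
      unfolding vector_minus_component vector_scaleR_component M_pow_diag_0_right M_pow_diag_0_left
        M_pow_diag_1_right M_pow_diag_1_left S[OF xy] S[OF yx] S1 xy w23
      by (simp add: f_def algebra_simps)
    then show "S x y z 2 - S y x z 2 = (f 3 - \<gamma> * f 2 - \<rho> * f 1) / ((q + 1 / q + 1) * f 2) * ?\<Delta> z"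
      using w22 b1 by (intro div) (simp_all add: f_def mult.assoc del: walks.simps)
  qed
  then obtain r2 where r2: "\<And>z. S x y z 2 - S y x z 2 = r2 * ?\<Delta> z" by blast
  have "\<exists>r. \<forall>z. S x y z 3 - S y x z 3 = r * ?\<Delta> z"
  proof (rule exI, rule allI)
    fix z
    have "(f 4 - \<gamma> * f 3 - \<rho> * f 2) * ?\<Delta> z - \<gamma> * (f 2 * (S x y z 2 - S y x z 2))
        - (q + 1 / q) * (f 3 * (S x y z 2 - S y x z 2) + walks 3 3 * (S x y z 3 - S y x z 3)) = 0"
      using arg_cong[OF tridiagonal_M_pow(2)[OF TD[of z]], of "\<lambda>X. X $ x $ y"]
      unfolding vector_minus_component vector_scaleR_component M_pow_diag_0_right M_pow_diag_0_left
        M_pow_diag_1_right M_pow_diag_1_left S[OF xy] S[OF yx] S1 xy w23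
      by (simp add: f_def algebra_simps)
    then have "(q + 1 / q) * walks 3 3 * (S x y z 3 - S y x z 3)
        = (f 4 - \<gamma> * f 3 - \<rho> * f 2 - \<gamma> * f 2 * r2 - (q + 1 / q) * f 3 * r2) * ?\<Delta> z"
      unfolding r2 by (simp add: algebra_simps)
    then show "S x y z 3 - S y x z 3
        = (f 4 - \<gamma> * f 3 - \<rho> * f 2 - \<gamma> * f 2 * r2 - (q + 1 / q) * f 3 * r2) / ((q + 1 / q) * walks 3 3) * ?\<Delta> z"
      using w33 b0 by (intro div) (simp_all del: walks.simps)
  qed
  then obtain r where r: "\<And>z. S x y z 3 - S y x z 3 = r * ?\<Delta> z" by blast
  \<comment> \<open>For \<open>z = x\<close> all summands in each sum are equal, which determines
    \<open>r\<close>.\<close>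
  have "S x y x 3 = real (b_num adj 2) * q powi (- 3)"
  proof -
    have "S x y x 3 = (\<Sum>w | adj y w \<and> d x w = 3. q powi (- 3))"
      unfolding S_def by (rule sum.cong) (auto simp: N_def)
    then show ?thesis using card_b[of y x] yx by simp
  qed
  moreover have "S y x x 3 = real (b_num adj 2) * q powi (- 1)"
  proof -
    have "S y x x 3 = (\<Sum>w | adj x w \<and> d y w = 3. q powi (- 1))"
      unfolding S_def by (rule sum.cong) (auto simp: N_def dist_adj)
    then show ?thesis using card_b[of x y] xy by simp
  qed
  ultimately have "real (b_num adj 2) * (q powi (- 3) - q powi (- 1)) = r * (q powi (- 2) - 1)"
    using r[of x] xy by (simp add: N_def algebra_simps)
  moreover have "q powi (- 3) - q powi (- 1) = (q powi (- 2) - 1) / q"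
    by (simp add: power_int_minus divide_simps power2_eq_square power3_eq_cube)
  moreover have "q powi (- 2) - 1 \<noteq> 0"
  proof -
    have "q\<^sup>2 > 1" using q_less by (simp add: power2_gt_1_iff)
    then show ?thesis by (simp add: power_int_minus)
  qed
  ultimately have "(q powi (- 2) - 1) * r = (q powi (- 2) - 1) * (real (b_num adj 2) / q)"
    by (simp add: mult_ac)
  then have "r = real (b_num adj 2) / q" using \<open>q powi (- 2) - 1 \<noteq> 0\<close> by (metis mult_cancel_left)
  then show ?thesis using r[of z] unfolding S_def by simp
qed

section \<open>Parallelograms and kites of length three, and induced \<open>K112\<close>\<close>

lemma no_kite_no_parallelogram:
  assumes diam: "3 \<le> diam adj" and xy: "d x y = 2" and xz: "adj x z" and zy: "d z y = 2"
  shows "{w. adj y w \<and> d x w = 3 \<and> d z w = 2} = {}" and "{w. adj x w \<and> adj z w \<and> d y w = 3} = {}"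
proof -
  \<comment> \<open>\<open>?n\<close> counts parallelograms and \<open>?p\<close> kites of length
    three. The distance from \<open>z\<close> takes only the values two and three in the first
    balanced sum, and one and two in the second.\<close>
  let ?n = "card {w. adj y w \<and> d x w = 3 \<and> d z w = 2}" and ?p = "card {w. adj x w \<and> adj z w \<and> d y w = 3}"
  let ?b = "b_num adj 2"
  have "(\<Sum>w | adj y w \<and> d x w = 3. N z w) = real ?n * (q powi - 2) + (real ?b - real ?n) * (q powi - 3)"
  proof -
    let ?I = "{w. adj y w \<and> d x w = 3 \<and> d z w = 2}" and ?J = "{w. adj y w \<and> d x w = 3 \<and> d z w = 3}"
    have u: "{w. adj y w \<and> d x w = 3} = ?I \<union> ?J"
    proof -
      have "d z w = 2 \<or> d z w = 3" if "adj y w" "d x w = 3" for w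
        using adj_dist_le[OF that(1), of z] adj_dist_le[OF xz, of w] that zy dist_commute[of w x]
          dist_commute[of w z] by linarith
      then show ?thesis by auto
    qed
    have "card {w. adj y w \<and> d x w = 3} = ?b"
      using card_b[of y x] xy dist_commute[of x y] by simp
    then have b: "?b = ?n + card ?J" unfolding u by (subst (asm) card_Un_disjoint) auto
    have "(\<Sum>w | adj y w \<and> d x w = 3. N z w) = (\<Sum>w\<in>?I. N z w) + (\<Sum>w\<in>?J. N z w)"
      unfolding u by (rule sum.union_disjoint) auto
    then show ?thesis by (simp add: N_def b)
  qed
  moreover have "(\<Sum>w | adj x w \<and> d y w = 3. N z w) = real ?p * (q powi - 1) + (real ?b - real ?p) * (q powi - 2)"
  proof -
    let ?I = "{w. adj x w \<and> adj z w \<and> d y w = 3}" and ?J = "{w. adj x w \<and> d z w = 2 \<and> d y w = 3}"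
    have u: "{w. adj x w \<and> d y w = 3} = ?I \<union> ?J"
    proof -
      have "adj z w \<or> d z w = 2" if "adj x w" "d y w = 3" for w
      proof -
        have "d z w \<noteq> 0" using that zy dist_commute[of y z] by auto
        moreover have "d z w \<le> 2"
          using dist_triangle[of z w x] dist_adj[OF that(1)] dist_adj[OF adj_sym[OF xz]] by simp
        ultimately have "d z w = 1 \<or> d z w = 2" by linarith
        then show ?thesis by (simp only: dist_eq_1_iff)
      qed
      then show ?thesis by auto
    qed
    have "card {w. adj x w \<and> d y w = 3} = ?b"
      using card_b[of x y] xy by simp
    then have b: "?b = ?p + card ?J" unfolding u
      by (subst (asm) card_Un_disjoint) (auto dest: dist_adj)
    have "(\<Sum>w | adj x w \<and> d y w = 3. N z w) = (\<Sum>w\<in>?I. N z w) + (\<Sum>w\<in>?J. N z w)"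
      unfolding u by (rule sum.union_disjoint) (auto dest: dist_adj)
    then show ?thesis by (simp add: N_def b dist_adj)
  qed
  moreover have "N z y = q powi - 2" "N z x = q powi - 1"
    using zy dist_adj[OF adj_sym[OF xz]] by (simp_all add: N_def)
  ultimately have "real ?n * (q powi - 2) + (real ?b - real ?n) * (q powi - 3)
      - (real ?p * (q powi - 1) + (real ?b - real ?p) * (q powi - 2))
      = real ?b / q * (q powi - 2 - q powi - 1)"
    using balanced[OF diam xy, of z] by simp
  moreover have q0: "q \<noteq> 0" using q_less by simp
  \<comment> \<open>Factoring out \<open>q powi - 3\<close> leaves a polynomial identity that
    collapses to \<open>?n = q * ?p\<close>.\<close>
  moreover define s where "s = q powi - 3"
  have s: "q powi - 1 = q * (q * s)" "q powi - 2 = q * s" "s \<noteq> 0"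
    using q0 by (simp_all add: s_def power_int_minus power2_eq_square power3_eq_cube field_simps)
  moreover have "real ?b / q * (q * s - q * (q * s)) = real ?b * (s - q * s)"
    using q0 by (simp add: field_simps)
  ultimately have "real ?n * (q * s) + (real ?b - real ?n) * s
      - (real ?p * (q * (q * s)) + (real ?b - real ?p) * (q * s)) = real ?b * (s - q * s)"
    by (simp only: s_def[symmetric] s)
  then have "(q - 1) * s * (real ?n - q * real ?p) = 0"
    by (simp add: algebra_simps)
  then have "real ?n = q * real ?p"
    using q_less s(3) by simp
  moreover have "q * real ?p \<le> 0" using q_less by (simp add: mult_nonpos_nonneg)
  ultimately have "real ?n = 0" "q * real ?p = 0" by linarith+
  then have "?n = 0" "?p = 0" using q_less by auto
  then show "{w. adj y w \<and> d x w = 3 \<and> d z w = 2} = {}" "{w. adj x w \<and> adj z w \<and> d y w = 3} = {}"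
    by (simp_all only: card_eq_0_iff finite simp_thms not_True_eq_False)
qed

text \<open>If \<open>w\<close> and \<open>z\<close> were at distance two, a neighbour
  \<open>y\<close> of \<open>z\<close> at distance three from \<open>w\<close> would form a kite of
  length three with the triangle \<open>u\<close>, \<open>v\<close>, \<open>w\<close>.\<close>

lemma no_K112:
  assumes diam: "3 \<le> diam adj" and uv: "adj u v" and "adj u w" "adj u z" "adj v w" "adj v z" and "w \<noteq> z"
  shows "adj w z"
proof (rule ccontr)
  assume n: "\<not> adj w z"
  have "d w z \<le> 2"
    using dist_triangle[of w z u] dist_adj[of w u] dist_adj[of u z] assms adj_sym by simp
  moreover have "d w z \<noteq> 0" "d w z \<noteq> 1" using assms n by (simp, simp only: dist_eq_1_iff not_False_eq_True)
  ultimately have wz: "d z w = 2" using dist_commute[of w z] by linarith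
  have "card {y. adj z y \<and> d w y = Suc (d z w)} \<noteq> 0"
    unfolding card_b using b_pos[of 2] wz diam by simp
  then obtain y where y: "adj z y" "d w y = 3" using wz by (auto simp: card_eq_0_iff numeral_3_eq_3)
  have "d t y = 2" if "adj t w" "adj t z" for t
    using dist_triangle[of t y z] dist_triangle[of w y t] dist_adj[OF that(1)] dist_adj[OF that(2)]
      dist_adj[OF y(1)] y(2) dist_commute[of w t] by linarith
  then have "d u y = 2" "d v y = 2" using assms by auto
  then show False
    using no_kite_no_parallelogram(2)[OF diam _ uv, of y] assms y dist_commute[of w y] by auto
qed

text \<open>The index \<open>i\<close> enters only through the two brackets. Their product is
  \<open>q + 1\<close> at \<open>i = 2\<close>, which is nonzero, so vanishing there forces
  vanishing for every \<open>i\<close> in the range.\<close>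

lemma a_num_classical:
  assumes "1 \<le> i" "i < diam adj"
  shows "real (a_num adj i) - real (a_num adj 1) * real (c_num adj i)
       = - \<alpha> * q_bracket q i * q_bracket q (i - 1) * (q + 1 + real (a_num adj 1))"
proof -
  have a: "real (a_num adj i) = real (b_num adj 0) - real (b_num adj i) - real (c_num adj i)"
    if "i < diam adj" for i
  proof -
    obtain y z :: 'a where "d y z = i" using ex_at_dist[of i] \<open>i < diam adj\<close> by (metis less_imp_le)
    then show ?thesis using valency[of y z] by simp
  qed
  \<comment> \<open>Since \<open>q_bracket q i = 1 + q * Y\<close>, the claim becomes a polynomial
    identity.\<close>
  define Y where "Y = q_bracket q (i - 1)"
  have X: "q_bracket q i = 1 + q * Y"
    using assms(1) unfolding Y_def q_bracket_def
    by (cases i) (simp_all add: sum.lessThan_Suc_shift sum_distrib_left del: sum.lessThan_Suc)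
  have Q: "q_bracket q 0 = 0" "q_bracket q 1 = 1" by (simp_all add: q_bracket_def)
  have b: "real (b_num adj j) = (q_bracket q (diam adj) - q_bracket q j) * (\<beta> - \<alpha> * q_bracket q j)"
    if "j < diam adj" for j
    using classical that by (simp add: has_classical_parameters_def)
  have c: "real (c_num adj j) = q_bracket q j * (1 + \<alpha> * q_bracket q (j - 1))" if "1 \<le> j" "j \<le> diam adj" for j
    using classical that by (simp add: has_classical_parameters_def)
  have bs: "real (b_num adj 0) = q_bracket q (diam adj) * \<beta>" "real (b_num adj 1) = (q_bracket q (diam adj) - 1) * (\<beta> - \<alpha>)"
    "real (b_num adj i) = (q_bracket q (diam adj) - (1 + q * Y)) * (\<beta> - \<alpha> * (1 + q * Y))"
    "real (c_num adj 1) = 1" "real (c_num adj i) = (1 + q * Y) * (1 + \<alpha> * Y)"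
    using b[of 0] b[of 1] b[of i] c[of 1] c[of i] assms X Y_def Q by simp_all
  show ?thesis
    unfolding a[OF assms(2)] a[OF le_less_trans[OF assms]] bs X Y_def[symmetric]
    by (simp add: algebra_simps)
qed

end

section \<open>Uniform structures\<close>

context distance_regular_graph begin

section \<open>The flat graph and its lowering and raising matrices\<close>

abbreviation flat :: "'a \<Rightarrow> 'a \<Rightarrow> 'a \<Rightarrow> bool" where "flat \<equiv> flat_graph adj"

text \<open>Along a geodesic from \<open>x\<close> the distance from \<open>x\<close> changes at
  every step, so the geodesic survives in the flat graph; deleting edges shortens no
  distance.\<close>

lemma gdist_flat: "gdist (flat x) x y = d x y"
  unfolding gdist_def[of "flat x"]
proof (rule Least_equality)
  have "\<And>n y. d x y = n \<Longrightarrow> (flat x ^^ n) x y"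
  proof -
    fix n y
    show "d x y = n \<Longrightarrow> (flat x ^^ n) x y"
    proof (induction n arbitrary: y)
      case 0 then show ?case by simp
    next
      case (Suc n)
      obtain z where z: "adj y z" "d x z = n" using closer_neighbour Suc.prems by blast
      then have "flat x z y" using Suc.prems adj_sym by (simp add: flat_graph_def)
      then show ?case using Suc.IH[OF z(2)] by auto
    qed
  qed
  then show "(flat x ^^ d x y) x y" by simp
next
  fix n assume "(flat x ^^ n) x y"
  then have "(adj ^^ n) x y"
    by (rule relpowp_mono[rotated]) (simp add: flat_graph_def)
  then show "d x y \<le> n" by (rule gdist_le)
qed

lemma ecc_flat: "ecc (flat x) x = diam adj"
  using ecc_eq_diam[of x] by (simp add: ecc_def gdist_flat)

lemma dual_idem_adj_matrix_entry:
  "(dual_idem (flat x) x i ** adj_matrix (flat x) ** dual_idem (flat x) x j) $ z $ y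
     = of_bool (d x z = i \<and> flat x z y \<and> d x y = j)"
proof -
  have "(dual_idem (flat x) x i ** adj_matrix (flat x)) $ z $ w = of_bool (d x z = i \<and> flat x z w)" for w
  proof -
    have "(dual_idem (flat x) x i ** adj_matrix (flat x)) $ z $ w
        = (\<Sum>k\<in>UNIV. of_bool (z = k \<and> d x z = i) * of_bool (flat x k w))"
      by (simp only: matrix_matrix_mult_def dual_idem_def adj_matrix_def gdist_flat vec_lambda_beta)
    also have "\<dots> = (\<Sum>k\<in>UNIV. if z = k then of_bool (d x z = i \<and> flat x z w) else 0)"
      by (rule sum.cong) auto
    finally show ?thesis by simp
  qed
  then have "(dual_idem (flat x) x i ** adj_matrix (flat x) ** dual_idem (flat x) x j) $ z $ y
      = (\<Sum>k\<in>UNIV. of_bool (d x z = i \<and> flat x z k) * of_bool (k = y \<and> d x k = j))"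
    unfolding matrix_matrix_mult_def[of "_ ** _" "dual_idem _ _ _"]
    by (simp only: vec_lambda_beta) (simp only: dual_idem_def gdist_flat vec_lambda_beta)
  also have "\<dots> = (\<Sum>k\<in>UNIV. if k = y then of_bool (d x z = i \<and> flat x z y \<and> d x y = j) else 0)"
    by (rule sum.cong) auto
  finally show ?thesis by simp
qed

lemma lowering_flat: "lowering (flat x) x $ z $ y = of_bool (adj z y \<and> d x y = Suc (d x z))"
proof -
  have "lowering (flat x) x $ z $ y
      = (\<Sum>i = 1..diam adj. of_bool (d x z = i - 1 \<and> flat x z y \<and> d x y = i))"
    unfolding lowering_def ecc_flat by (simp add: dual_idem_adj_matrix_entry)
  also have "\<dots> = (\<Sum>i = 1..diam adj. if i = d x y then of_bool (adj z y \<and> d x y = Suc (d x z)) else 0)"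
    by (rule sum.cong) (auto simp: flat_graph_def)
  also have "\<dots> = of_bool (adj z y \<and> d x y = Suc (d x z))"
    using dist_le_diam[of x y] by (auto simp: Suc_le_eq)
  finally show ?thesis .
qed

lemma raising_flat: "raising (flat x) x $ z $ y = of_bool (adj z y \<and> d x z = Suc (d x y))"
proof -
  have "raising (flat x) x $ z $ y
      = (\<Sum>i = 0..<diam adj. of_bool (d x z = i + 1 \<and> flat x z y \<and> d x y = i))"
    unfolding raising_def ecc_flat by (simp add: dual_idem_adj_matrix_entry)
  also have "\<dots> = (\<Sum>i = 0..<diam adj. if i = d x y then of_bool (adj z y \<and> d x z = Suc (d x y)) else 0)"
    by (rule sum.cong) (auto simp: flat_graph_def)
  also have "\<dots> = of_bool (adj z y \<and> d x z = Suc (d x y))"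
    using dist_le_diam[of x z] by auto
  finally show ?thesis .
qed

lemma sum_of_bool_card:
  "(\<Sum>k\<in>UNIV. of_bool (P k) * f k) = (\<Sum>k | P k. f k)" for f :: "'a \<Rightarrow> complex"
  by (simp add: of_bool_def if_distrib[where f="\<lambda>t. t * _"] sum.If_cases cong: if_cong)

lemma mult_axis_entry: "(Z *v axis y 1) $ i = Z $ i $ y" for Z :: "complex^'a^'a"
  by (simp add: matrix_vector_mult_def axis_def if_distrib[where f="\<lambda>t. _ * t"] cong: if_cong)

text \<open>The relation for \<open>i = 2\<close> is applied to the unit vector at \<open>y\<close>
  and read at \<open>z\<close>. \<open>R L L\<close> descends to \<open>x\<close> and rises to
  \<open>z\<close>; \<open>L R L\<close> descends to a common neighbour \<open>w\<close> of
  \<open>x\<close> and \<open>y\<close>, rises to \<open>u\<close> and descends to \<open>z\<close>;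
  \<open>L L R\<close> rises to \<open>u\<close> at distance three and descends twice.\<close>

lemma uniform_structure_2:
  assumes U: "supports_uniform_structure adj x" and diam: "3 \<le> diam adj"
  obtains em ep f :: complex where "em \<noteq> 0 \<or> ep \<noteq> 0"
    and "\<And>y z. d x y = 2 \<Longrightarrow> adj x z \<Longrightarrow>
       em * of_nat (c_num adj 2)
       + (\<Sum>w | adj x w \<and> adj y w. of_nat (card {u. adj z u \<and> adj w u \<and> d x u = 2}))
       + ep * (\<Sum>u | adj y u \<and> d x u = 3. of_nat (card {v. adj z v \<and> adj u v \<and> d x v = 2}))
       = f * of_bool (adj z y)"
proof -
  let ?L = "lowering (flat x) x" and ?R = "raising (flat x) x"
  obtain e f where pm: "parameter_matrix (diam adj) e"
    and eq: "\<And>i v. i \<in> {1..diam adj} \<Longrightarrow> v \<in> range ((*v) (dual_idem (flat x) x i)) \<Longrightarrow>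
          e_minus e i *s ((?R ** ?L ** ?L) *v v) + (?L ** ?R ** ?L) *v v
             + e_plus (diam adj) e i *s ((?L ** ?L ** ?R) *v v) = f i *s (?L *v v)"
    using U unfolding supports_uniform_structure_def admits_uniform_structure_def Let_def ecc_flat by metis
  \<comment> \<open>The first alternative is used at index \<open>2\<close>, the second at index
    \<open>3\<close>. As the diameter is at least three, row \<open>2\<close> is not the last one,
    where \<open>e_plus\<close> is zero by convention.\<close>
  have "e_minus e 2 \<noteq> 0 \<or> e_plus (diam adj) e 2 \<noteq> 0"
  proof -
    have "(\<forall>i\<in>{2..diam adj}. e i (i - 1) \<noteq> 0) \<or> (\<forall>i\<in>{2..diam adj}. e (i - 1) i \<noteq> 0)"
      using pm by (simp add: parameter_matrix_def)
    then show ?thesis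
    proof
      assume "\<forall>i\<in>{2..diam adj}. e i (i - 1) \<noteq> 0"
      then have "e 2 (2 - 1) \<noteq> 0" using diam by (intro bspec[where x=2]) auto
      then show ?thesis by (simp add: e_minus_def)
    next
      assume "\<forall>i\<in>{2..diam adj}. e (i - 1) i \<noteq> 0"
      then have "e (3 - 1) 3 \<noteq> 0" using diam by (rule_tac bspec[where x=3]) auto
      then show ?thesis using diam by (simp add: e_plus_def)
    qed
  qed
  moreover have "e_minus e 2 * of_nat (c_num adj 2)
       + (\<Sum>w | adj x w \<and> adj y w. of_nat (card {u. adj z u \<and> adj w u \<and> d x u = 2}))
       + e_plus (diam adj) e 2 * (\<Sum>u | adj y u \<and> d x u = 3. of_nat (card {v. adj z v \<and> adj u v \<and> d x v = 2}))
       = f 2 * of_bool (adj z y)" if y: "d x y = 2" and z: "adj x z" for y z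
  proof -
    have z1: "d x z = 1" using dist_adj[OF z] .
    have axis: "axis y 1 \<in> range ((*v) (dual_idem (flat x) x 2))"
    proof -
      have "axis y (1::complex) = dual_idem (flat x) x 2 *v axis y 1"
        unfolding Finite_Cartesian_Product.vec_eq_iff mult_axis_entry
        using y by (auto simp: dual_idem_def gdist_flat axis_def)
      then show ?thesis by (rule range_eqI)
    qed
    have "2 \<in> {1..diam adj}" using diam by simp
    from arg_cong[OF eq[OF this axis], of "\<lambda>v. v $ z"]
    have *: "e_minus e 2 * (?R ** (?L ** ?L)) $ z $ y + (?L ** ?R ** ?L) $ z $ y
       + e_plus (diam adj) e 2 * (?L ** ?L ** ?R) $ z $ y = f 2 * ?L $ z $ y"
      by (simp add: mult_axis_entry matrix_mul_assoc)
    have LL: "(?L ** ?L) $ s $ t = of_nat (card {w. adj s w \<and> adj t w \<and> d x w = Suc (d x s)})"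
      if "d x t = Suc (Suc (d x s))" for s t
    proof -
      have "(?L ** ?L) $ s $ t = (\<Sum>k\<in>UNIV. of_bool (adj s k \<and> adj t k \<and> d x k = Suc (d x s)))"
        unfolding matrix_matrix_mult_def vec_lambda_beta lowering_flat
        by (rule sum.cong) (use that in \<open>auto simp: adj_commute\<close>)
      then show ?thesis by (simp add: of_bool_def sum.If_cases)
    qed
    have LR: "(?L ** ?R) $ s $ t = of_nat (card {w. adj s w \<and> adj t w \<and> d x w = Suc (d x s)})"
      if "d x t = d x s" for s t
    proof -
      have "(?L ** ?R) $ s $ t = (\<Sum>k\<in>UNIV. of_bool (adj s k \<and> adj t k \<and> d x k = Suc (d x s)))"
        unfolding matrix_matrix_mult_def vec_lambda_beta lowering_flat raising_flat
        by (rule sum.cong) (use that in \<open>auto simp: adj_commute\<close>)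
      then show ?thesis by (simp add: of_bool_def sum.If_cases)
    qed
    have "(?R ** (?L ** ?L)) $ z $ y = of_nat (c_num adj 2)"
    proof -
      have "(?R ** (?L ** ?L)) $ z $ y = (\<Sum>k\<in>UNIV. if k = x then (?L ** ?L) $ x $ y else 0)"
        unfolding matrix_matrix_mult_def[of ?R] vec_lambda_beta raising_flat
        by (rule sum.cong) (use z z1 in \<open>auto simp: adj_commute\<close>)
      also have "\<dots> = of_nat (card {w. adj x w \<and> adj y w \<and> d x w = 1})"
        using LL[of y x] y by (simp add: numeral_2_eq_2)
      also have "{w. adj x w \<and> adj y w \<and> d x w = 1} = {w. adj y w \<and> Suc (d x w) = d y x}"
        using y dist_commute[of y x] dist_eq_1_iff by fastforce
      finally show ?thesis using card_c[of y x] y dist_commute[of y x] by simp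
    qed
    moreover have "(?L ** ?R ** ?L) $ z $ y
        = (\<Sum>w | adj x w \<and> adj y w. of_nat (card {u. adj z u \<and> adj w u \<and> d x u = 2}))"
    proof -
      have "(?L ** ?R ** ?L) $ z $ y
          = (\<Sum>w\<in>UNIV. of_bool (adj x w \<and> adj y w) * of_nat (card {u. adj z u \<and> adj w u \<and> d x u = 2}))"
        unfolding matrix_matrix_mult_def[of "?L ** ?R"]
      proof (simp only: vec_lambda_beta, rule sum.cong[OF refl])
        fix w
        show "(?L ** ?R) $ z $ w * ?L $ w $ y
            = of_bool (adj x w \<and> adj y w) * of_nat (card {u. adj z u \<and> adj w u \<and> d x u = 2})"
        proof (cases "adj x w \<and> adj y w")
          case True
          then have "d x w = 1" using dist_adj by blast
          then show ?thesis using True LR[of w z] z1 y by (simp add: lowering_flat adj_commute numeral_2_eq_2)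
        next
          case False
          then have "?L $ w $ y = 0" using y dist_eq_1_iff[of x w] by (auto simp: lowering_flat adj_commute)
          then show ?thesis using False by simp
        qed
      qed
      then show ?thesis unfolding sum_of_bool_card .
    qed
    moreover have "(?L ** ?L ** ?R) $ z $ y
        = (\<Sum>u | adj y u \<and> d x u = 3. of_nat (card {v. adj z v \<and> adj u v \<and> d x v = 2}))"
    proof -
      have "(?L ** ?L ** ?R) $ z $ y
          = (\<Sum>u\<in>UNIV. of_bool (adj y u \<and> d x u = 3) * of_nat (card {v. adj z v \<and> adj u v \<and> d x v = 2}))"
        unfolding matrix_matrix_mult_def[of "?L ** ?L"]
      proof (simp only: vec_lambda_beta, rule sum.cong[OF refl])
        fix u
        show "(?L ** ?L) $ z $ u * ?R $ u $ y
            = of_bool (adj y u \<and> d x u = 3) * of_nat (card {v. adj z v \<and> adj u v \<and> d x v = 2})"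
        proof (cases "adj y u \<and> d x u = 3")
          case True
          then show ?thesis using LL[of u z] z1 y by (simp add: raising_flat adj_commute numeral_2_eq_2)
        next
          case False
          then have "?R $ u $ y = 0" using y by (auto simp: raising_flat adj_commute)
          then show ?thesis using False by simp
        qed
      qed
      then show ?thesis unfolding sum_of_bool_card .
    qed
    moreover have "?L $ z $ y = of_bool (adj z y)"
      using y z1 by (simp add: lowering_flat)
    ultimately show ?thesis using * by simp
  qed
  ultimately show thesis by (rule that)
qed

end

section \<open>Counts of common neighbours in the absence of induced \<open>K112\<close>\<close>

context classical_graph begin

text \<open>A common neighbour of \<open>w\<close> and \<open>z\<close> adjacent to \<open>x\<close>
  would give an induced \<open>K112\<close>. So \<open>x\<close> is the only common neighbour that
  is not at distance two from \<open>x\<close>.\<close>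

lemma card_common_neighbours:
  assumes diam: "3 \<le> diam adj" and xw: "adj x w" and xz: "adj x z" and wz: "w \<noteq> z" "\<not> adj w z"
  shows "Suc (card {u. adj z u \<and> adj w u \<and> d x u = 2}) = c_num adj 2"
proof -
  have "d z w \<le> 2"
    using dist_triangle[of z w x] dist_adj[OF xw] dist_adj[OF adj_sym[OF xz]] by simp
  moreover have "d z w \<noteq> 0" "d z w \<noteq> 1"
    using wz by (simp, simp only: dist_eq_1_iff adj_commute[of z w] not_False_eq_True)
  ultimately have zw: "d z w = 2" by linarith
  have eq: "{u. adj z u \<and> Suc (d w u) = d z w} = insert x {u. adj z u \<and> adj w u \<and> d x u = 2}"
  proof (intro equalityI subsetI)
    fix u assume "u \<in> {u. adj z u \<and> Suc (d w u) = d z w}"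
    then have u: "adj z u" "d w u = 1" using zw by auto
    then have wu: "adj w u" by (simp only: dist_eq_1_iff)
    have "d x u \<noteq> 1"
    proof
      assume "d x u = 1"
      then have "adj x u" by (simp only: dist_eq_1_iff)
      then have "adj w z"
        by (rule no_K112[OF diam _ xw xz adj_sym[OF wu] adj_sym[OF u(1)] wz(1)])
      then show False using wz by simp
    qed
    moreover have "d x u \<le> 2" using dist_triangle[of x u z] dist_adj[OF xz] dist_adj[OF u(1)] by simp
    ultimately have "d x u = 0 \<or> d x u = 2" by linarith
    then show "u \<in> insert x {u. adj z u \<and> adj w u \<and> d x u = 2}" using u(1) wu by auto
  next
    fix u assume "u \<in> insert x {u. adj z u \<and> adj w u \<and> d x u = 2}"
    then have "adj z u" "adj w u" using xw xz adj_sym by auto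
    then show "u \<in> {u. adj z u \<and> Suc (d w u) = d z w}" using zw dist_adj by simp
  qed
  have "c_num adj 2 = card {u. adj z u \<and> Suc (d w u) = d z w}"
    using card_c[of z w] zw by simp
  also have "\<dots> = Suc (card {u. adj z u \<and> adj w u \<and> d x u = 2})"
    unfolding eq by (subst card_insert_disjoint) auto
  finally show ?thesis by simp
qed

lemma card_common_neighbours_adj:
  assumes diam: "3 \<le> diam adj" and "adj x w" "adj x z" "adj w z"
  shows "card {u. adj z u \<and> adj w u \<and> d x u = 2} = 0"
proof -
  have "d x u \<noteq> 2" if "adj z u" "adj w u" for u
  proof
    assume "d x u = 2"
    then have "x \<noteq> u" "\<not> adj x u" using dist_adj by auto
    then show False using no_K112[OF diam assms(4) adj_sym[OF assms(2)] that(2) adj_sym[OF assms(3)] that(1)] by simp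
  qed
  then have "{u. adj z u \<and> adj w u \<and> d x u = 2} = {}" by auto
  then show ?thesis by (simp only: card.empty)
qed

text \<open>By \<open>a_num_classical\<close>, equality at index two would give all the equalities
  defining a near polygon; the other defining condition holds by \<open>no_K112\<close>.\<close>

lemma a_num_2_neq:
  assumes diam: "3 \<le> diam adj" and "\<not> near_polygon adj"
  shows "a_num adj 1 * c_num adj 2 \<noteq> a_num adj 2"
proof
  assume eq: "a_num adj 1 * c_num adj 2 = a_num adj 2"
  have "real (a_num adj 2) - real (a_num adj 1) * real (c_num adj 2) = 0"
    using arg_cong[OF eq, of real] by simp
  moreover have "q_bracket q 2 = 1 + q" "q_bracket q (2 - 1) = 1"
    by (simp_all add: q_bracket_def numeral_2_eq_2)
  ultimately have "- \<alpha> * (1 + q) * 1 * (q + 1 + real (a_num adj 1)) = 0"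
    using a_num_classical[of 2] diam by simp
  then have zero: "\<alpha> * (q + 1 + real (a_num adj 1)) = 0"
    using q_less by simp
  have "a_num adj i = a_num adj 1 * c_num adj i" if i: "1 \<le> i" "i < diam adj" for i
  proof -
    have "- \<alpha> * q_bracket q i * q_bracket q (i - 1) * (q + 1 + real (a_num adj 1))
        = - q_bracket q i * q_bracket q (i - 1) * (\<alpha> * (q + 1 + real (a_num adj 1)))"
      by simp
    then have "real (a_num adj i) = real (a_num adj 1) * real (c_num adj i)"
      using a_num_classical[OF i] unfolding zero by linarith
    then show ?thesis by (simp only: of_nat_mult[symmetric] of_nat_eq_iff)
  qed
  moreover have "\<not> has_induced_K112 adj"
    unfolding has_induced_K112_def
  proof (intro notI, elim exE conjE)
    fix u v w z
    assume "distinct [u, v, w, z]" "adj u v" "adj u w" "adj u z" "adj v w" "adj v z" "\<not> adj w z"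
    then show False using no_K112[OF diam, of u v w z] by simp
  qed
  ultimately have "near_polygon adj" using regular unfolding near_polygon_def by blast
  then show False using assms by simp
qed

text \<open>For each common neighbour \<open>w\<close> of \<open>x\<close> and \<open>y\<close>, the
  common neighbours of \<open>x\<close> and \<open>w\<close> are \<open>a_num adj 1\<close> vertices
  at distance two from \<open>y\<close>. Without induced \<open>K112\<close> these sets are disjoint
  for different \<open>w\<close>, and by \<open>a_num_2_neq\<close> they cannot exhaust the
  \<open>a_num adj 2\<close> neighbours of \<open>x\<close> at distance two from
  \<open>y\<close>.\<close>

lemma ex_no_common_neighbour:
  assumes diam: "3 \<le> diam adj" and np: "\<not> near_polygon adj" and xy: "d x y = 2"
  obtains z where "adj x z" "d z y = 2" "\<And>w. adj x w \<Longrightarrow> adj y w \<Longrightarrow> \<not> adj w z"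
proof -
  let ?W = "{w. adj x w \<and> adj y w}"
  let ?A = "\<lambda>w. {z. adj x z \<and> adj w z}"
  have yx: "d y x = 2" using xy dist_commute[of x y] by simp
  have nadj: "x \<noteq> y" "\<not> adj x y" using xy dist_adj by auto
  have W: "card ?W = c_num adj 2"
  proof -
    have "?W = {w. adj x w \<and> Suc (d y w) = d x y}"
      using xy dist_eq_1_iff[of y] by auto
    then show ?thesis using card_c[of x y] xy by simp
  qed
  have indep: "\<not> adj w w'" if "w \<in> ?W" "w' \<in> ?W" for w w'
  proof
    assume a: "adj w w'"
    have "adj x w" "adj y w" "adj x w'" "adj y w'" using that by auto
    then have "adj x y"
      using no_K112[OF diam a _ _ _ _ nadj(1)] adj_sym by metis
    then show False using nadj by simp
  qed
  have A: "card (?A w) = a_num adj 1" if "w \<in> ?W" for w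
  proof -
    have "?A w = {z. adj x z \<and> d w z = d x w}"
      using that dist_eq_1_iff[of w] dist_adj[of x w] by auto
    then show ?thesis using card_a[of x w] that dist_adj[of x w] by simp
  qed
  have "card (\<Union>w\<in>?W. ?A w) = (\<Sum>w\<in>?W. card (?A w))"
  proof (rule card_UN_disjoint)
    show "\<forall>w\<in>?W. \<forall>w'\<in>?W. w \<noteq> w' \<longrightarrow> ?A w \<inter> ?A w' = {}"
    proof (intro ballI impI equals0I)
      fix w w' z assume w: "w \<in> ?W" "w' \<in> ?W" "w \<noteq> w'" and z: "z \<in> ?A w \<inter> ?A w'"
      have "adj x z" "adj x w" "adj x w'" "adj z w" "adj z w'" using w z adj_commute[of z] by auto
      then have "adj w w'" using no_K112[OF diam] w(3) by metis
      then show False using indep[OF w(1,2)] by simp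
    qed
  qed simp_all
  also have "\<dots> = c_num adj 2 * a_num adj 1" using A W by simp
  also have "\<dots> \<noteq> a_num adj 2" using a_num_2_neq[OF diam np] by (simp add: mult.commute)
  also have "a_num adj 2 = card {z. adj x z \<and> d y z = 2}" using card_a[of x y] xy by simp
  finally have "(\<Union>w\<in>?W. ?A w) \<noteq> {z. adj x z \<and> d y z = 2}" by metis
  moreover have "(\<Union>w\<in>?W. ?A w) \<subseteq> {z. adj x z \<and> d y z = 2}"
  proof
    fix z assume "z \<in> (\<Union>w\<in>?W. ?A w)"
    then obtain w where w: "adj x w" "adj y w" "adj x z" "adj w z" by blast
    have "d y z \<le> 2" using dist_triangle[of y z w] dist_adj[OF w(2)] dist_adj[OF w(4)] by simp
    moreover have "d y z \<noteq> 0" using w nadj by auto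
    moreover have "d y z \<noteq> 1"
    proof
      assume "d y z = 1"
      then have "z \<in> ?W" using w by (simp only: dist_eq_1_iff mem_Collect_eq)
      then show False using indep w by blast
    qed
    ultimately have "d y z = 2" by linarith
    then show "z \<in> {z. adj x z \<and> d y z = 2}" using w by simp
  qed
  ultimately obtain z where z: "adj x z" "d y z = 2" "z \<notin> (\<Union>w\<in>?W. ?A w)" by blast
  show thesis
  proof (rule that)
    show "adj x z" by (fact z(1))
    show "d z y = 2" using z(2) dist_commute[of y z] by simp
    show "\<not> adj w z" if "adj x w" "adj y w" for w using z that by blast
  qed
qed

section \<open>The contradiction from three instances of the uniform structure relation\<close>

lemma no_uniform_structure:
  assumes diam: "3 \<le> diam adj" and a1: "a_num adj 1 \<noteq> 0" and np: "\<not> near_polygon adj"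
  shows "\<not> supports_uniform_structure adj x"
proof
  assume "supports_uniform_structure adj x"
  then obtain em ep f :: complex where nz: "em \<noteq> 0 \<or> ep \<noteq> 0"
    and eq: "\<And>y z. d x y = 2 \<Longrightarrow> adj x z \<Longrightarrow>
       em * of_nat (c_num adj 2)
       + (\<Sum>w | adj x w \<and> adj y w. of_nat (card {u. adj z u \<and> adj w u \<and> d x u = 2}))
       + ep * (\<Sum>u | adj y u \<and> d x u = 3. of_nat (card {v. adj z v \<and> adj u v \<and> d x v = 2}))
       = f * of_bool (adj z y)"
    using uniform_structure_2[OF _ diam] by blast
  define c where "c = c_num adj 2"
  have c: "0 < c" using c_pos[of 2] diam by (simp add: c_def)
  have W: "card {w. adj x w \<and> adj y w} = c" if "d x y = 2" for y
  proof -
    have "{w. adj x w \<and> adj y w} = {w. adj x w \<and> Suc (d y w) = d x y}"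
      using that dist_eq_1_iff[of y] by auto
    then show ?thesis using card_c[of x y] that by (simp add: c_def)
  qed
  have card1: "(of_nat (card {u. adj z u \<and> adj w u \<and> d x u = 2}) :: complex) = of_nat c - 1"
    if "adj x w" "adj x z" "w \<noteq> z" "\<not> adj w z" for w z
    using arg_cong[OF card_common_neighbours[OF diam that], of "of_nat :: nat \<Rightarrow> complex"]
    by (simp add: c_def algebra_simps)
  \<comment> \<open>A vertex \<open>v\<close> counted here puts \<open>u\<close> at distance two
    from \<open>z\<close>, which completes a parallelogram of length three.\<close>
  have up0: "(\<Sum>u | adj y u \<and> d x u = 3. of_nat (card {v. adj z v \<and> adj u v \<and> d x v = 2})) = (0::complex)"
    if xy: "d x y = 2" and xz: "adj x z" and zy: "d z y = 2" for y z
  proof (rule sum.neutral, rule ballI)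
    fix u assume u: "u \<in> {u. adj y u \<and> d x u = 3}"
    have "{v. adj z v \<and> adj u v \<and> d x v = 2} = {}"
    proof (rule equals0I)
      fix v assume v: "v \<in> {v. adj z v \<and> adj u v \<and> d x v = 2}"
      have "d z u \<le> 2" using dist_triangle[of z u v] v dist_adj[of z v] dist_adj[of v u] adj_sym by auto
      moreover have "3 \<le> d z u + 1"
        using dist_triangle[of x u z] u dist_adj[OF xz] by simp
      ultimately have "d z u = 2" by linarith
      then show False using no_kite_no_parallelogram(1)[OF diam xy xz zy] u by blast
    qed
    then show "of_nat (card {v. adj z v \<and> adj u v \<and> d x v = 2}) = (0::complex)" by (simp only: card.empty of_nat_0)
  qed
  \<comment> \<open>The triangle \<open>x\<close>, \<open>z\<close>, \<open>w\<close> exists because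
    \<open>a_num adj 1\<close> is nonzero, and \<open>y\<close> is a neighbour of \<open>w\<close>
    at distance two from \<open>x\<close>. Of the \<open>c\<close> common neighbours of
    \<open>x\<close> and \<open>y\<close>, \<open>w\<close> contributes zero and each other one
    \<open>c - 1\<close>.\<close>
  have B: "em * of_nat c + (of_nat c - 1) * (of_nat c - 1) = 0"
  proof -
    obtain z where "d x z = 1" using ex_at_dist[of 1] diam by auto
    then have xz: "adj x z" by (simp only: dist_eq_1_iff)
    have "card {w. adj x w \<and> d z w = d x z} \<noteq> 0" unfolding card_a using a1 \<open>d x z = 1\<close> by simp
    then obtain w where w: "adj x w" "d z w = 1" using \<open>d x z = 1\<close> by (auto simp: card_eq_0_iff)
    have zw: "adj z w" using w(2) by (simp only: dist_eq_1_iff)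
    have wx: "d x w = 1" "d w x = 1" using dist_adj[OF w(1)] dist_adj[OF adj_sym[OF w(1)]] by auto
    have "card {y. adj w y \<and> d x y = Suc (d w x)} \<noteq> 0"
      unfolding card_b using b_pos[of 1] diam wx by simp
    then obtain y where y: "adj w y" "d x y = 2" using wx by (auto simp: card_eq_0_iff numeral_2_eq_2)
    have nadj: "x \<noteq> y" "\<not> adj x y" using y dist_adj by auto
    have nzy: "\<not> adj z y"
      using no_K112[OF diam adj_sym[OF zw] adj_sym[OF w(1)] y(1) adj_sym[OF xz]] nadj by blast
    have "d z y \<le> 2" using dist_triangle[of z y w] dist_adj[OF zw] dist_adj[OF y(1)] by simp
    moreover have "d z y \<noteq> 0" using xz nadj by auto
    moreover have "d z y \<noteq> 1" using nzy by (simp only: dist_eq_1_iff not_False_eq_True)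
    ultimately have zy: "d z y = 2" by linarith
    let ?W = "{w. adj x w \<and> adj y w}"
    have wW: "w \<in> ?W" using w(1) adj_sym[OF y(1)] by simp
    have "(\<Sum>w\<in>?W. of_nat (card {u. adj z u \<and> adj w u \<and> d x u = 2}) :: complex)
        = of_nat (card {u. adj z u \<and> adj w u \<and> d x u = 2})
          + (\<Sum>w\<in>?W - {w}. of_nat (card {u. adj z u \<and> adj w u \<and> d x u = 2}))"
      using wW by (simp add: sum.remove)
    also have "of_nat (card {u. adj z u \<and> adj w u \<and> d x u = 2}) = (0::complex)"
      using card_common_neighbours_adj[OF diam w(1) xz adj_sym[OF zw]] by simp
    also have "(\<Sum>w\<in>?W - {w}. of_nat (card {u. adj z u \<and> adj w u \<and> d x u = 2}) :: complex)
        = (\<Sum>w\<in>?W - {w}. of_nat c - 1)"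
    proof (rule sum.cong[OF refl])
      fix w' assume w': "w' \<in> ?W - {w}"
      have w'a: "adj x w'" "adj y w'" "w \<noteq> w'" using w' by auto
      have "w' \<noteq> z" using w'a(2) nzy adj_commute[of z y] by auto
      moreover have "\<not> adj w' z"
      proof
        assume a: "adj w' z"
        have "adj w w'" by (rule no_K112[OF diam xz w(1) w'a(1) zw adj_sym[OF a] w'a(3)])
        then have "adj x y"
          by (rule no_K112[OF diam _ adj_sym[OF w(1)] y(1) adj_sym[OF w'a(1)] adj_sym[OF w'a(2)] nadj(1)])
        then show False using nadj by simp
      qed
      ultimately show "of_nat (card {u. adj z u \<and> adj w' u \<and> d x u = 2}) = (of_nat c - 1 :: complex)"
        by (intro card1 w'a(1) xz)
    qed
    also have "\<dots> = (of_nat c - 1) * (of_nat c - 1)"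
      using wW W[OF y(2)] c by (simp add: of_nat_diff Suc_leI)
    finally show ?thesis
      using eq[OF y(2) xz] up0[OF y(2) xz zy] nzy by (simp add: c_def)
  qed
  \<comment> \<open>Here no common neighbour of \<open>x\<close> and \<open>y\<close> is adjacent to
    \<open>z\<close>, so all \<open>c\<close> of them contribute \<open>c - 1\<close>.\<close>
  have C: "em * of_nat c + of_nat c * (of_nat c - 1) = 0"
  proof -
    obtain y where y: "d x y = 2" using ex_at_dist[of 2] diam by auto
    obtain z where xz: "adj x z" and zy: "d z y = 2" and n: "\<And>w. adj x w \<Longrightarrow> adj y w \<Longrightarrow> \<not> adj w z"
      using ex_no_common_neighbour[OF diam np y] by blast
    have nzy: "\<not> adj z y" using zy dist_adj by auto
    have "(\<Sum>w | adj x w \<and> adj y w. of_nat (card {u. adj z u \<and> adj w u \<and> d x u = 2}) :: complex)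
        = (\<Sum>w | adj x w \<and> adj y w. of_nat c - 1)"
    proof (rule sum.cong[OF refl])
      fix w assume "w \<in> {w. adj x w \<and> adj y w}"
      then show "of_nat (card {u. adj z u \<and> adj w u \<and> d x u = 2}) = (of_nat c - 1 :: complex)"
        using card1[OF _ xz] n nzy adj_commute[of y] by auto
    qed
    also have "\<dots> = of_nat c * (of_nat c - 1)" using W[OF y] by simp
    finally show ?thesis
      using eq[OF y xz] up0[OF y xz zy] nzy by (simp add: c_def)
  qed
  \<comment> \<open>Subtracting \<open>C\<close> from \<open>B\<close> leaves
    \<open>1 - c = 0\<close>.\<close>
  have "(of_nat c :: complex) = 1" using B C by (simp add: algebra_simps)
  then have c1: "c = 1" by simp
  then have "em = 0" using C by simp
  then have ep: "ep \<noteq> 0" using nz by simp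
  obtain y where y: "d x y = 2" using ex_at_dist[of 2] diam by auto
  then have "card {z. adj x z \<and> d y z = Suc (d x y)} \<noteq> 0"
    unfolding card_b using b_pos[of 2] diam by simp
  then obtain z where xz: "adj x z" and yz: "d y z = 3"
    using y by (auto simp: card_eq_0_iff numeral_3_eq_3)
  have zy: "d z y = 3" using yz dist_commute[of y z] by simp
  have nzy: "\<not> adj z y" using zy dist_adj by auto
  have zx: "d z x = 1" using dist_adj[OF adj_sym[OF xz]] .
  have "(\<Sum>w | adj x w \<and> adj y w. of_nat (card {u. adj z u \<and> adj w u \<and> d x u = 2})) = (0::complex)"
  proof (rule sum.neutral, rule ballI)
    fix w assume w: "w \<in> {w. adj x w \<and> adj y w}"
    have "w \<noteq> z" using w nzy adj_commute[of y z] by auto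
    moreover have "\<not> adj w z"
    proof
      assume "adj w z"
      then show False
        using dist_triangle[of y z w] dist_adj[of y w] dist_adj[of w z] w yz by simp
    qed
    ultimately show "of_nat (card {u. adj z u \<and> adj w u \<and> d x u = 2}) = (0::complex)"
      using card1[of w z] w xz c1 by simp
  qed
  \<comment> \<open>Only the last sum of the relation survives, with the nonzero factor
    \<open>ep\<close>. It is a sum of natural numbers, so each term is zero.\<close>
  then have "(of_nat (\<Sum>u | adj y u \<and> d x u = 3. card {v. adj z v \<and> adj u v \<and> d x v = 2}) :: complex) = 0"
    using eq[OF y xz] \<open>em = 0\<close> ep nzy by simp
  then have "(\<Sum>u | adj y u \<and> d x u = 3. card {v. adj z v \<and> adj u v \<and> d x v = 2}) = 0"
    by (simp only: of_nat_eq_0_iff)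
  then have none: "{v. adj z v \<and> adj u v \<and> d x v = 2} = {}" if "adj y u" "d x u = 3" for u
    using that by (simp add: sum_eq_0_iff)
  \<comment> \<open>If \<open>u\<close> were at distance three from \<open>x\<close>, the next
    vertex on a geodesic from \<open>u\<close> to \<open>z\<close> would contradict
    \<open>none\<close>; at distance two there would be a parallelogram. Distance one remains, and
    comparing cardinalities bounds \<open>c_num adj 3\<close> by \<open>c_num adj 2\<close>.\<close>
  have sub: "{u. adj y u \<and> Suc (d z u) = d y z} \<subseteq> {u. adj y u \<and> Suc (d x u) = d y x}"
  proof
    fix u assume "u \<in> {u. adj y u \<and> Suc (d z u) = d y z}"
    then have u: "adj y u" "d z u = 2" using yz by auto
    have yx: "d y x = 2" using y dist_commute[of x y] by simp
    have "d x u \<noteq> 3"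
    proof
      assume xu: "d x u = 3"
      have "d u z = Suc 1" using u dist_commute[of z u] by simp
      then obtain v where v: "adj z v" "d u v = 1" by (rule closer_neighbour)
      then have uv: "adj u v" by (simp only: dist_eq_1_iff)
      have "d x v \<le> 2" using dist_triangle[of x v z] dist_adj[OF xz] dist_adj[OF v(1)] by simp
      moreover have "2 \<le> d x v" using dist_triangle[of x u v] xu dist_adj[OF adj_sym[OF uv]] by simp
      ultimately have "d x v = 2" by linarith
      then show False using none[OF u(1) xu] v(1) uv by blast
    qed
    moreover have "d x u \<noteq> 2"
    proof
      assume "d x u = 2"
      then show False
        using no_kite_no_parallelogram(1)[OF diam u(2) adj_sym[OF xz]] adj_sym[OF u(1)] zy y by blast
    qed
    moreover have "d x u \<le> 3" "1 \<le> d x u"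
      using adj_dist_le[OF u(1), of x] y by auto
    ultimately have "d x u = 1" by linarith
    then show "u \<in> {u. adj y u \<and> Suc (d x u) = d y x}" using u(1) yx by simp
  qed
  have "c_num adj 3 \<le> c_num adj 2"
    using card_mono[OF _ sub] unfolding card_c using yz y dist_commute[of x y] by simp
  then have "real (c_num adj 3) \<le> 1" using c1 by (simp add: c_def)
  \<comment> \<open>\<open>c_num adj 2 = 1\<close> determines
    \<open>\<alpha> * (1 + q) = - q\<close>, which turns \<open>c_num adj 3\<close> into
    \<open>1 - q ^ 3\<close>; this exceeds one because \<open>q\<close> is negative.\<close>
  moreover have "(1 + q) * (1 + \<alpha>) = 1" "real (c_num adj 3) = (1 + q + q\<^sup>2) * (1 + \<alpha> * (1 + q))"
  proof -
    have "real (c_num adj j) = q_bracket q j * (1 + \<alpha> * q_bracket q (j - 1))" if "1 \<le> j" "j \<le> diam adj" for j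
      using classical that by (simp add: has_classical_parameters_def)
    from this[of 2] this[of 3] c1 diam
    show "(1 + q) * (1 + \<alpha>) = 1" "real (c_num adj 3) = (1 + q + q\<^sup>2) * (1 + \<alpha> * (1 + q))"
      by (simp_all add: c_def q_bracket_def numeral_2_eq_2 numeral_3_eq_3)
  qed
  moreover from this(1) have "1 + \<alpha> * (1 + q) = 1 - q"
    by (simp add: algebra_simps)
  ultimately have "real (c_num adj 3) = (1 + q + q\<^sup>2) * (1 - q)" "real (c_num adj 3) \<le> 1"
    by simp_all
  then have "real (c_num adj 3) = 1 - q * q\<^sup>2" "real (c_num adj 3) \<le> 1"
    by (simp_all add: algebra_simps power2_eq_square)
  moreover have "q * q\<^sup>2 < 0" using q_less by (simp add: mult_neg_pos)
  ultimately show False by linarith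
qed

end

theorem theorem6p4:
  fixes adj :: "'a::finite \<Rightarrow> 'a \<Rightarrow> bool"
    and x :: 'a
    and D :: nat
    and q \<alpha> \<beta> :: real
  assumes "connected_simple_graph adj"
    and "\<not> bipartite adj"
    and "distance_regular adj"
    and "diam adj = D"
    and "D \<ge> 3"
    and "has_classical_parameters adj D q \<alpha> \<beta>"
    and "q < -1"
    and "a_num adj 1 \<noteq> 0"
    and "\<not> near_polygon adj"
  shows "\<not> supports_uniform_structure adj x"
proof -
  interpret classical_graph adj q \<alpha> \<beta>
    using assms by unfold_locales auto
  show ?thesis using assms by (intro no_uniform_structure) auto
qed

end
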